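(* Let $k,l,m,n$ be integers such that $n=k(m-l)+l$, where $k\geq 1$, $m\geq 2$ and $1\le l<\lceil \frac{m}{2}\rceil$. Let $K$ be a field, $R=K[x_1,\dots,x_n]$, and let $I_{m,l,k}=(u_1,\dots,u_k)\subseteq R$ with $u_i=\prod_{j=1}^{m}x_{(i-1)(m-l)+j}$ for $1\leq i\leq k$. Then $\mathrm{pd}(I_{m,l,k})=k-1$ and $\mathrm{reg}(I_{m,l,k})=(k-1)(m-l-1)+m$.
   Context: $R$ is graded in the standard way ($\deg x_i=1$), and $\lceil a\rceil$ denotes the smallest integer $\ge a$. For a homogeneous ideal $I\subseteq R$, $\beta_{i,j}(I)$ denotes the $(i,j)$-th graded Betti number of $I$ viewed as an $R$-module, i.e. the number of copies of $R(-j)$ in homological degree $i$ of the minimal graded free resolution of $I$ over $R$. The projective dimension is $\mathrm{pd}(I)=\max\{i : \beta_{i,j}(I)\neq 0 \text{ for some } j\}$ and the (Castelnuovo-Mumford) regularity is $\mathrm{reg}(I)=\max\{j-i : \beta_{i,j}(I)\neq 0\}$. These are invariants of the ideal $I$ as a module, not of $R/I$. *)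

theory Defs
  imports "HOL-Algebra.Algebra" "HOL-Library.Poly_Mapping"
begin

text \<open>
  A monomial is a finitely supported exponent function \<open>nat \<Rightarrow>\<^sub>0 nat\<close>. The polynomial ring
  in \<open>x_1, \<dots>, x_n\<close> consists of the polynomials in countably many variables that only
  involve the variables with index in \<open>{1..n}\<close>.
\<close>

type_synonym 'k mpoly = "(nat \<Rightarrow>\<^sub>0 nat) \<Rightarrow>\<^sub>0 'k"

definition mvar :: "nat \<Rightarrow> 'k::field mpoly" where
  "mvar i = Poly_Mapping.single (Poly_Mapping.single i 1) 1"

definition mpoly_ring :: "nat \<Rightarrow> 'k::field mpoly ring" where
  "mpoly_ring n =
    \<lparr>carrier = {p. \<forall>t\<in>Poly_Mapping.keys p. Poly_Mapping.keys t \<subseteq> {1..n}},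
     monoid.mult = (*), monoid.one = 1, ring.zero = 0, ring.add = (+)\<rparr>"

definition total_degree :: "(nat \<Rightarrow>\<^sub>0 nat) \<Rightarrow> nat" where
  "total_degree t = (\<Sum>i\<in>Poly_Mapping.keys t. Poly_Mapping.lookup t i)"

text \<open>
  Degrees are integers, so that \<open>R(-j)\<close> makes sense for every integer \<open>j\<close>; for \<open>d < 0\<close>
  only the zero polynomial is homogeneous of degree \<open>d\<close>.
\<close>

definition homogeneous :: "int \<Rightarrow> 'k::field mpoly \<Rightarrow> bool" where
  "homogeneous d p \<longleftrightarrow> (\<forall>t\<in>Poly_Mapping.keys p. int (total_degree t) = d)"

record ('a, 'b) graded_module = "('a, 'b) module" +
  component :: "int \<Rightarrow> 'b set"

definition ideal_module :: "'k::field mpoly set \<Rightarrow> ('k mpoly, 'k mpoly) graded_module" where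
  "ideal_module I =
    \<lparr>carrier = I, monoid.mult = (*), monoid.one = 1, ring.zero = 0, ring.add = (+), module.smult = (*),
     component = (\<lambda>d. {p \<in> I. homogeneous d p})\<rparr>"

text \<open>
  The finitely generated graded free module \<open>R(-d_0) \<oplus> \<dots> \<oplus> R(-d_{r-1})\<close> for
  \<open>D = [d_0, \<dots>, d_{r-1}]\<close>: its elements are coordinate vectors (padded with zeros), and the
  \<open>s\<close>-th basis vector has degree \<open>d_s\<close>. The record fields for a ring multiplication play no
  role in a module.
\<close>

definition free_module :: "nat \<Rightarrow> int list \<Rightarrow> ('k::field mpoly, nat \<Rightarrow> 'k mpoly) graded_module" where
  "free_module n D =
    \<lparr>carrier = {v. (\<forall>s<length D. v s \<in> carrier (mpoly_ring n)) \<and> (\<forall>s\<ge>length D. v s = 0)},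
     monoid.mult = undefined, monoid.one = undefined,
     ring.zero = (\<lambda>s. 0), ring.add = (\<lambda>v w s. v s + w s), module.smult = (\<lambda>a v s. a * v s),
     component = (\<lambda>d. {v. (\<forall>s<length D. v s \<in> carrier (mpoly_ring n) \<and> homogeneous (d - D ! s) (v s)) \<and>
                          (\<forall>s\<ge>length D. v s = 0)})\<rparr>"

definition irrelevant_ideal :: "nat \<Rightarrow> 'k::field mpoly set" where
  "irrelevant_ideal n = Idl\<^bsub>mpoly_ring n\<^esub> (mvar ` {1..n})"

text \<open>The submodule \<open>\<mm>F\<close> of a free module \<open>F\<close>, with \<open>\<mm> = (x_1, \<dots>, x_n)\<close>.\<close>

definition irrelevant_submodule :: "nat \<Rightarrow> int list \<Rightarrow> (nat \<Rightarrow> 'k::field mpoly) set" where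
  "irrelevant_submodule n D =
    {v \<in> carrier (free_module n D). \<forall>s<length D. v s \<in> irrelevant_ideal n}"

definition graded_hom ::
  "('a, 'r) ring_scheme \<Rightarrow> ('a, 'b, 'm) graded_module_scheme \<Rightarrow> ('a, 'c, 'n) graded_module_scheme
     \<Rightarrow> ('b \<Rightarrow> 'c) set" where
  "graded_hom R M N =
    {f \<in> carrier M \<rightarrow> carrier N.
      (\<forall>x\<in>carrier M. \<forall>y\<in>carrier M. f (x \<oplus>\<^bsub>M\<^esub> y) = f x \<oplus>\<^bsub>N\<^esub> f y) \<and>
      (\<forall>a\<in>carrier R. \<forall>x\<in>carrier M. f (a \<odot>\<^bsub>M\<^esub> x) = a \<odot>\<^bsub>N\<^esub> f x) \<and>
      (\<forall>d. f ` component M d \<subseteq> component N d)}"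

text \<open>
  \<open>min_graded_free_resolution n I D e \<phi>\<close>: with \<open>F_i = free_module n (D i)\<close>, the sequence
  \<open>\<dots> \<rightarrow> F_2 \<rightarrow> F_1 \<rightarrow> F_0 \<rightarrow> I \<rightarrow> 0\<close> with augmentation \<open>e : F_0 \<rightarrow> I\<close> and differentials
  \<open>\<phi> i : F_{i+1} \<rightarrow> F_i\<close> is a minimal graded free resolution of \<open>I\<close> over the polynomial ring in
  \<open>n\<close> variables. The sequence is not assumed to have finite length; a finite resolution
  has \<open>D i = []\<close> for all large \<open>i\<close>.
\<close>

definition min_graded_free_resolution ::
  "nat \<Rightarrow> 'k::field mpoly set \<Rightarrow> (nat \<Rightarrow> int list) \<Rightarrow> ((nat \<Rightarrow> 'k mpoly) \<Rightarrow> 'k mpoly) \<Rightarrow>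
     (nat \<Rightarrow> (nat \<Rightarrow> 'k mpoly) \<Rightarrow> (nat \<Rightarrow> 'k mpoly)) \<Rightarrow> bool" where
  "min_graded_free_resolution n I D e \<phi> \<longleftrightarrow>
     e \<in> graded_hom (mpoly_ring n) (free_module n (D 0)) (ideal_module I) \<and>
     (\<forall>i. \<phi> i \<in> graded_hom (mpoly_ring n) (free_module n (D (Suc i))) (free_module n (D i))) \<and>
     e ` carrier (free_module n (D 0)) = I \<and>
     \<phi> 0 ` carrier (free_module n (D 1)) = a_kernel (free_module n (D 0)) (ideal_module I) e \<and>
     (\<forall>i. \<phi> (Suc i) ` carrier (free_module n (D (Suc (Suc i))))
            = a_kernel (free_module n (D (Suc i))) (free_module n (D i)) (\<phi> i)) \<and>
     (\<forall>i. \<phi> i ` carrier (free_module n (D (Suc i))) \<subseteq> irrelevant_submodule n (D i))"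

text \<open>
  A minimal graded free resolution is only unique up to isomorphism, so one is chosen; the
  number of copies of \<open>R(-j)\<close> does not depend on the choice.
\<close>

definition min_resolution_degrees :: "nat \<Rightarrow> 'k::field mpoly set \<Rightarrow> nat \<Rightarrow> int list" where
  "min_resolution_degrees n I = (SOME D. \<exists>e \<phi>. min_graded_free_resolution n I D e \<phi>)"

definition betti :: "nat \<Rightarrow> 'k::field mpoly set \<Rightarrow> nat \<Rightarrow> int \<Rightarrow> nat" where
  "betti n I i j = count_list (min_resolution_degrees n I i) j"

text \<open>\<open>Max\<close> is unspecified on infinite sets, so values of \<open>pd\<close> and \<open>reg\<close> carry information only
  for ideals with finite resolutions.\<close>

definition pd :: "nat \<Rightarrow> 'k::field mpoly set \<Rightarrow> nat" where
  "pd n I = Max {i. \<exists>j. betti n I i j \<noteq> 0}"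

definition reg :: "nat \<Rightarrow> 'k::field mpoly set \<Rightarrow> int" where
  "reg n I = Max {j - int i | i j. betti n I i j \<noteq> 0}"

definition path_monomial :: "nat \<Rightarrow> nat \<Rightarrow> nat \<Rightarrow> 'k::field mpoly" where
  "path_monomial m l i = (\<Prod>j=1..m. mvar ((i - 1) * (m - l) + j))"

definition path_ideal :: "nat \<Rightarrow> nat \<Rightarrow> nat \<Rightarrow> nat \<Rightarrow> 'k::field mpoly set" where
  "path_ideal n m l k = Idl\<^bsub>mpoly_ring n\<^esub> (path_monomial m l ` {1..k})"

end

theory Submission
  imports Defs
begin

text \<open>
  Since \<open>2 l < m\<close>, each generator \<open>u\<^sub>j\<close> is divisible by a variable that divides no other generator.
  Hence the least common multiples of distinct sets \<open>S\<close> of generators properly divide one another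
  along inclusions, so the Taylor resolution, with one basis element of degree
  \<open>deg (lcm S)\<close> in homological degree \<open>card S - 1\<close> for every nonempty \<open>S\<close>, is minimal. Adding a
  generator to \<open>S\<close> increases the degree of the lcm by at least one, so projective dimension and
  regularity are both attained at the full set, whose lcm is \<open>x\<^sub>1 \<cdots> x\<^sub>n\<close>. As Betti numbers are read off
  an arbitrarily chosen minimal resolution, one also needs that all minimal resolutions have the same
  degrees: comparison maps in both directions compose to the identity up to homotopy, hence to the
  identity modulo the irrelevant ideal.
\<close>

text \<open>Betti numbers are read off \<open>min_resolution_degrees\<close>, an unspecified choice
  that is meaningful only once some minimal resolution exists. The Taylor complex therefore serves
  twice: it shows that there is something to choose from, and it is the model with which the chosen
  resolution is compared. \<open>pd\<close> and \<open>reg\<close> depend only on which Betti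
  numbers vanish, so it is enough that two minimal resolutions have the same set of degrees in each
  position; multiplicities are never compared. Reduction modulo the irrelevant ideal is carried out
  by taking constant coefficients. A homogeneous matrix entry with nonzero constant coefficient has
  degree 0 and hence links basis elements of equal degree; this is how a degree is carried from one
  resolution to the other. Squarefreeness of the generators turns lcms into unions of sets and
  degrees into cardinalities, which reduces both invariants to counting.\<close>

abbreviation lookup :: "('a \<Rightarrow>\<^sub>0 'b) \<Rightarrow> 'a \<Rightarrow> 'b::zero" where "lookup \<equiv> Poly_Mapping.lookup"
abbreviation keys :: "('a \<Rightarrow>\<^sub>0 'b::zero) \<Rightarrow> 'a set" where "keys \<equiv> Poly_Mapping.keys"

subsection \<open>Polynomials\<close>

text \<open>Only the exponent \<open>t - a\<close> of \<open>p\<close> can contribute. The guard is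
  essential for exponent functions, where subtraction is truncated and \<open>t - a\<close> makes
  sense even if \<open>a\<close> does not divide \<open>t\<close>.\<close>

lemma lookup_single_mult:
  fixes p :: "('a::cancel_comm_monoid_add) \<Rightarrow>\<^sub>0 ('b::comm_ring_1)"
  shows "lookup (Poly_Mapping.single a c * p) t = (if \<exists>s. t = a + s then c * lookup p (t - a) else 0)"
proof -
  have "lookup (Poly_Mapping.single a c * p) t
      = Sum_any (\<lambda>l. lookup (Poly_Mapping.single a c) l * Sum_any (\<lambda>q. lookup p q when t = l + q))"
    by (simp add: lookup_mult)
  also have "\<dots> = Sum_any (\<lambda>l. c * Sum_any (\<lambda>q. lookup p q when t = l + q) when a = l)"
    by (intro Sum_any.cong) (simp add: lookup_single when_def)
  also have "\<dots> = c * Sum_any (\<lambda>q. lookup p q when t = a + q)"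
    by simp
  also have "Sum_any (\<lambda>q. lookup p q when t = a + q) = (if \<exists>s. t = a + s then lookup p (t - a) else 0)"
  proof (cases "\<exists>s. t = a + s")
    case True
    then obtain s where "t = a + s" by blast
    then show ?thesis by (simp add: Sum_any_when_equal')
  next
    case False
    then show ?thesis by (simp add: when_def)
  qed
  finally show ?thesis by simp
qed

lemma total_degree_superset:
  assumes "finite B" "keys t \<subseteq> B"
  shows "total_degree t = (\<Sum>i\<in>B. lookup t i)"
  unfolding total_degree_def using assms
  by (intro sum.mono_neutral_left) (auto simp: in_keys_iff)

lemma keys_add_nat: "keys (s + t) = keys s \<union> keys (t :: nat \<Rightarrow>\<^sub>0 nat)"
  by (auto simp: in_keys_iff lookup_add)

lemma total_degree_add: "total_degree (s + t) = total_degree s + total_degree t"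
proof -
  have "total_degree u = (\<Sum>i\<in>keys s \<union> keys t. lookup u i)" if "keys u \<subseteq> keys s \<union> keys t" for u
    using that by (intro total_degree_superset) auto
  then show ?thesis
    by (simp add: keys_add_nat lookup_add sum.distrib)
qed

text \<open>The exponent 0 decomposes only as \<open>0 + 0\<close>. Taking constant coefficients is
  thus a ring homomorphism to the field, and stands in for reduction modulo the irrelevant
  ideal.\<close>

lemma lookup_mult_0:
  fixes p q :: "'k::field mpoly"
  shows "lookup (p * q) 0 = lookup p 0 * lookup q 0"
proof -
  have "lookup (p * q) 0 = Sum_any (\<lambda>l. lookup p l * Sum_any (\<lambda>r. lookup q r when 0 = l + r))"
    by (simp add: lookup_mult)
  also have "\<dots> = Sum_any (\<lambda>l. lookup p l * lookup q 0 when l = 0)"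
  proof (intro Sum_any.cong)
    fix l :: "nat \<Rightarrow>\<^sub>0 nat"
    have "0 = l + r \<longleftrightarrow> l = 0 \<and> r = 0" for r
      by (auto simp: poly_mapping_eq_iff fun_eq_iff lookup_add)
    then show "lookup p l * Sum_any (\<lambda>r. lookup q r when 0 = l + r) = (lookup p l * lookup q 0 when l = 0)"
      by (cases "l = 0") (simp_all add: when_def[where P = False])
  qed
  finally show ?thesis by simp
qed

abbreviation mpolys :: "nat \<Rightarrow> 'k::field mpoly set" where
  "mpolys n \<equiv> carrier (mpoly_ring n)"

lemma mpolys_iff: "p \<in> mpolys n \<longleftrightarrow> (\<forall>t\<in>keys p. keys t \<subseteq> {1..n})"
  by (simp add: mpoly_ring_def)

lemma mpoly_ring_simps [simp]:
  "monoid.mult (mpoly_ring n) = (*)" "monoid.one (mpoly_ring n) = 1"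
  "ring.zero (mpoly_ring n) = 0" "ring.add (mpoly_ring n) = (+)"
  by (simp_all add: mpoly_ring_def)

lemma mpolys_0 [simp]: "0 \<in> mpolys n"
  and mpolys_1 [simp]: "1 \<in> mpolys n"
  and mpolys_add [simp]: "p \<in> mpolys n \<Longrightarrow> q \<in> mpolys n \<Longrightarrow> p + q \<in> mpolys n"
  by (auto simp: mpolys_iff dest: subsetD[OF keys_add])

lemma mpolys_uminus [simp]: "p \<in> mpolys n \<Longrightarrow> - p \<in> mpolys n"
  by (auto simp: mpolys_iff in_keys_iff)

lemma mpolys_diff [simp]: "p \<in> mpolys n \<Longrightarrow> q \<in> mpolys n \<Longrightarrow> p - q \<in> mpolys n"
  using mpolys_add[OF _ mpolys_uminus, of p n q] by simp

lemma mpolys_mult [simp]: "p \<in> mpolys n \<Longrightarrow> q \<in> mpolys n \<Longrightarrow> p * q \<in> mpolys n"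
  unfolding mpolys_iff
proof
  fix t assume pq: "\<forall>t\<in>keys p. keys t \<subseteq> {1..n}" "\<forall>t\<in>keys q. keys t \<subseteq> {1..n}" and "t \<in> keys (p * q)"
  then obtain a b where "t = a + b" "a \<in> keys p" "b \<in> keys q" using keys_mult by blast
  then show "keys t \<subseteq> {1..n}" using pq by (auto simp: keys_add_nat)
qed

lemma mpolys_sum [simp]: "(\<And>x. x \<in> A \<Longrightarrow> f x \<in> mpolys n) \<Longrightarrow> (\<Sum>x\<in>A. f x) \<in> mpolys n"
  by (induction A rule: infinite_finite_induct) auto

lemma mpolys_single: "keys t \<subseteq> {1..n} \<Longrightarrow> Poly_Mapping.single t c \<in> mpolys n"
  by (auto simp: mpolys_iff split: if_splits)

section \<open>Ideals of the polynomial ring\<close>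

lemma cring_mpoly_ring: "cring (mpoly_ring n :: 'k::field mpoly ring)"
proof (rule cringI)
  show "abelian_group (mpoly_ring n :: 'k mpoly ring)"
    by (rule abelian_groupI) (auto simp: add_ac intro: bexI[of _ "- x" for x])
  show "comm_monoid (mpoly_ring n :: 'k mpoly ring)"
    by (rule comm_monoidI) (auto simp: mult_ac)
qed (auto simp: algebra_simps)

lemmas ring_mpoly_ring = cring.axioms(1)[OF cring_mpoly_ring]

lemma ideal_mpoly_ringI:
  assumes "I \<subseteq> mpolys n" "0 \<in> I" "\<And>p q. p \<in> I \<Longrightarrow> q \<in> I \<Longrightarrow> p + q \<in> I"
    and "\<And>p q. p \<in> I \<Longrightarrow> q \<in> mpolys n \<Longrightarrow> q * p \<in> I"
  shows "ideal I (mpoly_ring n :: 'k::field mpoly ring)"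
proof (rule idealI[OF ring_mpoly_ring])
  have min: "\<ominus>\<^bsub>mpoly_ring n\<^esub> p = - p" if "p \<in> mpolys n" for p :: "'k mpoly"
    using that by (intro abelian_group.minus_equality ring.is_abelian_group ring_mpoly_ring) auto
  interpret cring "mpoly_ring n :: 'k mpoly ring" by (rule cring_mpoly_ring)
  show "subgroup I (add_monoid (mpoly_ring n))"
  proof (rule add.subgroupI)
    show "\<ominus>\<^bsub>mpoly_ring n\<^esub> p \<in> I" if "p \<in> I" for p
      using that assms(1) assms(4)[of p "- 1"] min[of p] by auto
  qed (use assms in auto)
qed (use assms in \<open>auto simp: mult.commute\<close>)

lemma ideal_mpoly_ringD:
  assumes "ideal I (mpoly_ring n :: 'k::field mpoly ring)"
  shows "I \<subseteq> mpolys n" "0 \<in> I" "p \<in> I \<Longrightarrow> q \<in> I \<Longrightarrow> p + q \<in> I"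
    "p \<in> I \<Longrightarrow> q \<in> mpolys n \<Longrightarrow> q * p \<in> I"
proof -
  interpret ideal I "mpoly_ring n :: 'k mpoly ring" by fact
  show "I \<subseteq> mpolys n" "0 \<in> I" "p \<in> I \<Longrightarrow> q \<in> I \<Longrightarrow> p + q \<in> I"
    "p \<in> I \<Longrightarrow> q \<in> mpolys n \<Longrightarrow> q * p \<in> I"
    using Icarr additive_subgroup.zero_closed[OF is_additive_subgroup]
      additive_subgroup.a_closed[OF is_additive_subgroup, of p q] I_l_closed[of p q]
    by auto
qed

lemma ideal_mpoly_ring_sum:
  assumes "ideal I (mpoly_ring n :: 'k::field mpoly ring)" "\<And>x. x \<in> A \<Longrightarrow> f x \<in> I"
  shows "(\<Sum>x\<in>A. f x) \<in> I"
  using assms(2)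
  by (induction A rule: infinite_finite_induct) (auto simp: ideal_mpoly_ringD[OF assms(1)])

lemma genideal_image:
  fixes u :: "'a \<Rightarrow> 'k::field mpoly"
  assumes "finite J" "u ` J \<subseteq> mpolys n"
  shows "Idl\<^bsub>mpoly_ring n\<^esub> (u ` J) = {\<Sum>j\<in>J. v j * u j | v. v ` J \<subseteq> mpolys n}" (is "?L = ?R")
proof
  interpret cring "mpoly_ring n :: 'k mpoly ring" by (rule cring_mpoly_ring)
  have ideal: "ideal ?L (mpoly_ring n)" by (rule genideal_ideal[OF assms(2)])
  show "?R \<subseteq> ?L"
  proof safe
    fix v :: "'a \<Rightarrow> 'k mpoly" assume "v ` J \<subseteq> mpolys n"
    then show "(\<Sum>j\<in>J. v j * u j) \<in> ?L"
      using genideal_self[OF assms(2)]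
      by (intro ideal_mpoly_ring_sum[OF ideal] ideal_mpoly_ringD(4)[OF ideal]) auto
  qed
  show "?L \<subseteq> ?R"
  proof (rule genideal_minimal)
    show "ideal ?R (mpoly_ring n)"
    proof (rule ideal_mpoly_ringI)
      show "?R \<subseteq> mpolys n" using assms by (auto simp: image_subset_iff)
      show "0 \<in> ?R" by (auto intro!: exI[of _ "\<lambda>_. 0"])
    next
      fix p q :: "'k mpoly" assume "p \<in> ?R" "q \<in> ?R"
      then obtain v w where "v ` J \<subseteq> mpolys n" "w ` J \<subseteq> mpolys n"
        "p = (\<Sum>j\<in>J. v j * u j)" "q = (\<Sum>j\<in>J. w j * u j)" by blast
      then show "p + q \<in> ?R"
        by (auto intro!: exI[of _ "\<lambda>j. v j + w j"] simp: image_subset_iff sum.distrib distrib_right)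
    next
      fix p q :: "'k mpoly" assume "p \<in> ?R" "q \<in> mpolys n"
      then obtain v where "v ` J \<subseteq> mpolys n" "p = (\<Sum>j\<in>J. v j * u j)" by blast
      then show "q * p \<in> ?R" using \<open>q \<in> mpolys n\<close>
        by (auto intro!: exI[of _ "\<lambda>j. q * v j"] simp: image_subset_iff sum_distrib_left mult.assoc)
    qed
    show "u ` J \<subseteq> ?R"
    proof safe
      fix j assume "j \<in> J"
      then have "u j = (\<Sum>i\<in>J. (if i = j then 1 else 0) * u i)"
        using assms(1) by (simp add: sum.delta' if_distrib[of "\<lambda>x. x * _"] cong: if_cong)
      moreover have "(\<lambda>i. if i = j then 1 else 0) ` J \<subseteq> (mpolys n :: 'k mpoly set)" by auto
      ultimately show "\<exists>v. u j = (\<Sum>i\<in>J. v i * u i) \<and> v ` J \<subseteq> mpolys n" by (intro exI conjI)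
    qed
  qed
qed

section \<open>The irrelevant ideal\<close>

lemma mvar_in_mpolys: "i \<in> {1..n} \<Longrightarrow> mvar i \<in> mpolys n"
  unfolding mvar_def by (rule mpolys_single) auto

lemma ideal_irrelevant: "ideal (irrelevant_ideal n) (mpoly_ring n :: 'k::field mpoly ring)"
proof -
  interpret cring "mpoly_ring n :: 'k mpoly ring" by (rule cring_mpoly_ring)
  show ?thesis unfolding irrelevant_ideal_def
    by (rule genideal_ideal) (auto simp: mvar_in_mpolys simp del: One_nat_def)
qed

lemma mvar_in_irrelevant:
  assumes "i \<in> {1..n}"
  shows "(mvar i :: 'k::field mpoly) \<in> irrelevant_ideal n"
proof -
  interpret cring "mpoly_ring n :: 'k mpoly ring" by (rule cring_mpoly_ring)
  show ?thesis
    unfolding irrelevant_ideal_def using assms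
    by (intro subsetD[OF genideal_self]) (auto simp: mvar_in_mpolys simp del: One_nat_def)
qed

text \<open>The polynomials without constant term form an ideal that contains all variables, and the
  irrelevant ideal is the least such ideal.\<close>

lemma irrelevant_constant:
  assumes "p \<in> irrelevant_ideal n"
  shows "lookup (p :: 'k::field mpoly) 0 = 0"
proof -
  interpret cring "mpoly_ring n :: 'k mpoly ring" by (rule cring_mpoly_ring)
  have "irrelevant_ideal n \<subseteq> {p \<in> mpolys n. lookup (p :: 'k mpoly) 0 = 0}"
    unfolding irrelevant_ideal_def
  proof (rule genideal_minimal)
    show "ideal {p \<in> mpolys n. lookup (p :: 'k mpoly) 0 = 0} (mpoly_ring n)"
      by (rule ideal_mpoly_ringI) (auto simp: lookup_add lookup_mult_0)
    have "Poly_Mapping.single i (1::nat) \<noteq> 0" for i :: nat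
      by (metis lookup_single_eq lookup_zero zero_neq_one)
    then show "mvar ` {1..n} \<subseteq> {p \<in> mpolys n. lookup (p :: 'k mpoly) 0 = 0}"
      by (auto simp: mvar_in_mpolys mvar_def lookup_single simp del: One_nat_def)
        (auto intro!: mpolys_single)
  qed
  then show ?thesis using assms by blast
qed

lemma monomial_in_irrelevant:
  assumes "keys t \<subseteq> {1..n}" "t \<noteq> 0"
  shows "(Poly_Mapping.single t c :: 'k::field mpoly) \<in> irrelevant_ideal n"
proof -
  obtain i where i: "i \<in> keys t" using assms(2) keys_eq_empty by blast
  define s where "s = t - Poly_Mapping.single i 1"
  have t: "t = s + Poly_Mapping.single i 1"
    using i by (intro poly_mapping_eqI) (auto simp: s_def lookup_add lookup_minus lookup_single when_def in_keys_iff)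
  have "Poly_Mapping.single t c = Poly_Mapping.single s c * (mvar i :: 'k mpoly)"
    by (simp add: t mvar_def mult_single)
  moreover have "keys s \<subseteq> {1..n}" using assms(1) unfolding t by (auto simp: keys_add_nat)
  moreover have "i \<in> {1..n}" using assms(1) i by blast
  ultimately show ?thesis
    by (auto intro!: ideal_mpoly_ringD(4)[OF ideal_irrelevant] mvar_in_irrelevant mpolys_single simp del: One_nat_def)
qed

section \<open>Homogeneous polynomials and homogeneous components\<close>

lemma homogeneous_0 [simp]: "homogeneous d 0"
  by (simp add: homogeneous_def)

lemma homogeneous_1: "homogeneous 0 1"
  by (simp add: homogeneous_def total_degree_def)

lemma homogeneous_add: "homogeneous d p \<Longrightarrow> homogeneous d q \<Longrightarrow> homogeneous d (p + q)"
  by (auto simp: homogeneous_def dest: subsetD[OF keys_add])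

lemma homogeneous_uminus: "homogeneous d p \<Longrightarrow> homogeneous d (- p)"
  by (auto simp: homogeneous_def in_keys_iff)

lemma homogeneous_diff: "homogeneous d p \<Longrightarrow> homogeneous d q \<Longrightarrow> homogeneous d (p - q)"
  using homogeneous_add[OF _ homogeneous_uminus, of d p q] by simp

lemma homogeneous_sum: "(\<And>x. x \<in> A \<Longrightarrow> homogeneous d (f x)) \<Longrightarrow> homogeneous d (\<Sum>x\<in>A. f x)"
  by (induction A rule: infinite_finite_induct) (auto simp: homogeneous_add)

lemma homogeneous_mult: "homogeneous d p \<Longrightarrow> homogeneous e q \<Longrightarrow> homogeneous (d + e) (p * q)"
  by (fastforce simp: homogeneous_def total_degree_add dest!: subsetD[OF keys_mult])

lemma homogeneous_single: "int (total_degree t) = d \<Longrightarrow> homogeneous d (Poly_Mapping.single t c)"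
  by (auto simp: homogeneous_def split: if_splits)

definition hom_part :: "int \<Rightarrow> 'k::field mpoly \<Rightarrow> 'k mpoly" where
  "hom_part d p = Abs_poly_mapping (\<lambda>t. if int (total_degree t) = d then lookup p t else 0)"

lemma lookup_hom_part: "lookup (hom_part d p) t = (if int (total_degree t) = d then lookup p t else 0)"
proof -
  have "finite {t. (if int (total_degree t) = d then lookup p t else 0) \<noteq> 0}"
    by (rule finite_subset[OF _ finite_lookup[of p]]) auto
  then show ?thesis by (simp add: hom_part_def)
qed

lemma homogeneous_hom_part: "homogeneous d (hom_part d p)"
  by (auto simp: homogeneous_def in_keys_iff lookup_hom_part split: if_splits)

lemma hom_part_homogeneous: "homogeneous d p \<Longrightarrow> hom_part d p = p"
  by (rule poly_mapping_eqI) (auto simp: homogeneous_def in_keys_iff lookup_hom_part)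

lemma hom_part_add: "hom_part d (p + q) = hom_part d p + hom_part d q"
  by (rule poly_mapping_eqI) (simp add: lookup_hom_part lookup_add)

lemma hom_part_0 [simp]: "hom_part d 0 = 0"
  by (rule poly_mapping_eqI) (simp add: lookup_hom_part)

lemma hom_part_sum: "hom_part d (\<Sum>x\<in>A. f x) = (\<Sum>x\<in>A. hom_part d (f x))"
  by (induction A rule: infinite_finite_induct) (auto simp: hom_part_add)

lemma hom_part_in_mpolys: "p \<in> mpolys n \<Longrightarrow> hom_part d p \<in> mpolys n"
  by (auto simp: mpolys_iff in_keys_iff lookup_hom_part split: if_splits)

text \<open>Only \<open>q\<close> has to be homogeneous: the terms of \<open>p\<close> outside
  degree \<open>d\<close> yield terms of the product outside degree \<open>d + e\<close>. This makes
  taking components commute with homogeneous matrices.\<close>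

lemma hom_part_mult:
  assumes "homogeneous e q"
  shows "hom_part (d + e) (p * q) = hom_part d p * q"
proof -
  define r where "r = p - hom_part d p"
  have "p * q = hom_part d p * q + r * q" by (simp add: r_def algebra_simps)
  moreover have "hom_part (d + e) (hom_part d p * q) = hom_part d p * q"
    by (intro hom_part_homogeneous homogeneous_mult homogeneous_hom_part assms)
  moreover have "hom_part (d + e) (r * q) = 0"
  proof (rule poly_mapping_eqI)
    fix t
    have False if t: "int (total_degree t) = d + e" "t \<in> keys (r * q)"
    proof -
      obtain a b where ab: "t = a + b" "a \<in> keys r" "b \<in> keys q" using t(2) keys_mult by blast
      then have "int (total_degree a) = d"
        using t(1) assms by (auto simp: homogeneous_def total_degree_add)
      then have "lookup r a = 0" by (simp add: r_def lookup_minus lookup_hom_part)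
      then show False using ab by (simp add: in_keys_iff)
    qed
    then show "lookup (hom_part (d + e) (r * q)) t = lookup 0 t"
      by (auto simp: lookup_hom_part in_keys_iff)
  qed
  ultimately show ?thesis by (simp add: hom_part_add)
qed

subsection \<open>Homomorphisms of graded free modules\<close>

abbreviation free :: "nat \<Rightarrow> int list \<Rightarrow> (nat \<Rightarrow> 'k::field mpoly) set" where
  "free n D \<equiv> carrier (free_module n D)"

abbreviation free_hom where
  "free_hom n D E \<equiv> graded_hom (mpoly_ring n) (free_module n D) (free_module n E)"

lemma free_iff: "v \<in> free n D \<longleftrightarrow> (\<forall>s<length D. v s \<in> mpolys n) \<and> (\<forall>s\<ge>length D. v s = 0)"
  by (simp add: free_module_def)

lemma free_component_iff:
  "v \<in> component (free_module n D) d \<longleftrightarrow> v \<in> free n D \<and> (\<forall>s<length D. homogeneous (d - D ! s) (v s))"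
  by (auto simp: free_module_def)

lemma free_module_simps [simp]:
  "ring.zero (free_module n D) = (\<lambda>s. 0)" "ring.add (free_module n D) = (\<lambda>v w s. v s + w s)"
  "module.smult (free_module n D) = (\<lambda>a v s. a * v s)"
  by (simp_all add: free_module_def)

lemma free_coord: "v \<in> free n D \<Longrightarrow> v s \<in> mpolys n"
  by (cases "s < length D") (auto simp: free_iff)

lemma free_zero [simp]: "(\<lambda>s. 0) \<in> free n D"
  and free_add [simp]: "v \<in> free n D \<Longrightarrow> w \<in> free n D \<Longrightarrow> (\<lambda>s. v s + w s) \<in> free n D"
  and free_diff [simp]: "v \<in> free n D \<Longrightarrow> w \<in> free n D \<Longrightarrow> (\<lambda>s. v s - w s) \<in> free n D"
  and free_smult [simp]: "a \<in> mpolys n \<Longrightarrow> v \<in> free n D \<Longrightarrow> (\<lambda>s. a * v s) \<in> free n D"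
  by (auto simp: free_iff)

lemma free_sum [simp]: "(\<And>x. x \<in> A \<Longrightarrow> f x \<in> free n D) \<Longrightarrow> (\<lambda>s. \<Sum>x\<in>A. f x s) \<in> free n D"
  by (auto simp: free_iff)

lemma free_homI:
  assumes "\<And>v. v \<in> free n D \<Longrightarrow> f v \<in> free n E"
    and "\<And>v w. v \<in> free n D \<Longrightarrow> w \<in> free n D \<Longrightarrow> f (\<lambda>s. v s + w s) = (\<lambda>s. f v s + f w s)"
    and "\<And>a v. a \<in> mpolys n \<Longrightarrow> v \<in> free n D \<Longrightarrow> f (\<lambda>s. a * v s) = (\<lambda>s. a * f v s)"
    and "\<And>d v. v \<in> component (free_module n D) d \<Longrightarrow> f v \<in> component (free_module n E) d"
  shows "f \<in> free_hom n D E"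
  using assms by (auto simp: graded_hom_def)

lemma free_homD:
  assumes "f \<in> free_hom n D E"
  shows "v \<in> free n D \<Longrightarrow> f v \<in> free n E"
    and "v \<in> free n D \<Longrightarrow> w \<in> free n D \<Longrightarrow> f (\<lambda>s. v s + w s) = (\<lambda>s. f v s + f w s)"
    and "a \<in> mpolys n \<Longrightarrow> v \<in> free n D \<Longrightarrow> f (\<lambda>s. a * v s) = (\<lambda>s. a * f v s)"
    and "v \<in> component (free_module n D) d \<Longrightarrow> f v \<in> component (free_module n E) d"
  using assms by (auto simp: graded_hom_def image_subset_iff)

lemma free_hom_zero:
  assumes "f \<in> free_hom n D E"
  shows "f (\<lambda>s. 0) = (\<lambda>s. 0)"
  using free_homD(3)[OF assms mpolys_0 free_zero] by simp

lemma free_hom_diff: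
  assumes f: "f \<in> free_hom n D E" and v: "v \<in> free n D" and w: "w \<in> free n D"
  shows "f (\<lambda>s. v s - w s) = (\<lambda>s. f v s - f w s)"
proof -
  have "f (\<lambda>s. (v s - w s) + w s) = (\<lambda>s. f (\<lambda>s. v s - w s) s + f w s)"
    using v w by (intro free_homD(2)[OF f]) auto
  then show ?thesis by (auto simp: fun_eq_iff)
qed

lemma free_hom_sum:
  assumes f: "f \<in> free_hom n D E" and "\<And>x. x \<in> A \<Longrightarrow> v x \<in> free n D"
  shows "f (\<lambda>s. \<Sum>x\<in>A. v x s) = (\<lambda>s. \<Sum>x\<in>A. f (v x) s)"
  using assms(2)
  by (induction A rule: infinite_finite_induct) (simp_all add: free_homD(2)[OF f] free_hom_zero[OF f])

definition unit_vec :: "nat \<Rightarrow> nat \<Rightarrow> 'k::field mpoly" where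
  "unit_vec s = (\<lambda>t. if t = s then 1 else 0)"

lemma unit_vec_component: "s < length D \<Longrightarrow> unit_vec s \<in> component (free_module n D) (D ! s)"
  by (auto simp: free_component_iff free_iff unit_vec_def homogeneous_1)

lemma unit_vec_free: "s < length D \<Longrightarrow> unit_vec s \<in> free n D"
  using unit_vec_component free_component_iff by blast

lemma free_hom_expand:
  assumes f: "f \<in> free_hom n D E" and v: "v \<in> free n D"
  shows "f v t = (\<Sum>s<length D. v s * f (unit_vec s) t)"
proof -
  have expand: "v = (\<lambda>t. \<Sum>s<length D. v s * unit_vec s t)"
  proof
    fix t
    have "v s * unit_vec s t = (if s = t then v t else 0)" for s by (simp add: unit_vec_def)
    then show "v t = (\<Sum>s<length D. v s * unit_vec s t)" using v by (auto simp: free_iff)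
  qed
  have "f v = f (\<lambda>t. \<Sum>s<length D. v s * unit_vec s t)"
    using expand by (rule arg_cong)
  also have "\<dots> = (\<lambda>t. \<Sum>s<length D. f (\<lambda>t. v s * unit_vec s t) t)"
    using v by (intro free_hom_sum[OF f] free_smult) (auto simp: unit_vec_free free_coord)
  also have "\<dots> = (\<lambda>t. \<Sum>s<length D. v s * f (unit_vec s) t)"
    using v by (intro ext sum.cong refl) (simp add: free_homD(3)[OF f] unit_vec_free free_coord)
  finally show ?thesis by simp
qed

lemma free_hom_matrix:
  fixes M :: "nat \<Rightarrow> nat \<Rightarrow> 'k::field mpoly"
  assumes M: "\<And>s. s < length D \<Longrightarrow> M s \<in> component (free_module n E) (D ! s)"
  shows "(\<lambda>v t. \<Sum>s<length D. v s * M s t) \<in> free_hom n D E"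
proof (rule free_homI)
  have M': "M s \<in> free n E" if "s < length D" for s using M[OF that] by (simp add: free_component_iff)
  show *: "(\<lambda>t. \<Sum>s<length D. v s * M s t) \<in> free n E" if "v \<in> free n D" for v :: "nat \<Rightarrow> 'k mpoly"
    using that M' by (intro free_sum free_smult free_coord) auto
  show "(\<lambda>t. \<Sum>s<length D. v s * M s t) \<in> component (free_module n E) d"
    if v: "v \<in> component (free_module n D) d" for v :: "nat \<Rightarrow> 'k mpoly" and d
    unfolding free_component_iff
  proof (intro conjI allI impI homogeneous_sum)
    show "(\<lambda>t. \<Sum>s<length D. v s * M s t) \<in> free n E" using v * by (simp add: free_component_iff)
    fix t s assume "t < length E" "s \<in> {..<length D}"
    then have "homogeneous ((d - D ! s) + (D ! s - E ! t)) (v s * M s t)"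
      using v M[of s] by (intro homogeneous_mult) (auto simp: free_component_iff)
    then show "homogeneous (d - E ! t) (v s * M s t)" by simp
  qed
qed (auto simp: sum.distrib distrib_right sum_distrib_left mult.assoc)

lemma free_hom_id: "(\<lambda>v. v) \<in> free_hom n D D"
  by (rule free_homI) auto

lemma free_hom_zero_map: "(\<lambda>v s. 0) \<in> free_hom n D E"
  by (rule free_homI) (auto simp: free_component_iff)

lemma free_hom_comp:
  assumes "f \<in> free_hom n D E" "g \<in> free_hom n E F"
  shows "(\<lambda>v. g (f v)) \<in> free_hom n D F"
  by (rule free_homI) (simp_all add: free_homD[OF assms(1)] free_homD[OF assms(2)])

lemma free_hom_minus:
  fixes f g :: "(nat \<Rightarrow> 'k::field mpoly) \<Rightarrow> nat \<Rightarrow> 'k mpoly"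
  assumes "f \<in> free_hom n D E" "g \<in> free_hom n D E"
  shows "(\<lambda>v s. f v s - g v s) \<in> free_hom n D E"
proof (rule free_homI)
  fix v :: "nat \<Rightarrow> 'k mpoly" and d assume "v \<in> component (free_module n D) d"
  then show "(\<lambda>s. f v s - g v s) \<in> component (free_module n E) d"
    using free_homD(4)[OF assms(1)] free_homD(4)[OF assms(2)]
    by (auto simp: free_component_iff intro!: homogeneous_diff)
qed (simp_all add: free_homD[OF assms(1)] free_homD[OF assms(2)] algebra_simps)

text \<open>Exactness is stated for whole carriers, so it yields preimages that need not be
  homogeneous. The entries of the matrix of \<open>f\<close> are homogeneous, hence \<open>f\<close>
  commutes with passing to components, and the degree-\<open>d\<close> component of any preimage is
  again a preimage.\<close>

lemma graded_preimage:
  assumes f: "f \<in> free_hom n D E" and w: "w \<in> free n D" and fw: "f w \<in> component (free_module n E) d"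
  shows "\<exists>w'\<in>component (free_module n D) d. f w' = f w"
proof -
  define w' where "w' = (\<lambda>s. if s < length D then hom_part (d - D ! s) (w s) else 0)"
  have w': "w' \<in> component (free_module n D) d"
    using w by (auto simp: w'_def free_component_iff free_iff hom_part_in_mpolys homogeneous_hom_part)
  then have w'_free: "w' \<in> free n D" by (simp add: free_component_iff)
  have "f w' t = f w t" for t
  proof (cases "t < length E")
    case True
    have hom: "homogeneous (D ! s - E ! t) (f (unit_vec s) t)" if "s < length D" for s
      using free_homD(4)[OF f unit_vec_component[OF that]] True by (simp add: free_component_iff)
    have "f w' t = (\<Sum>s<length D. hom_part (d - D ! s) (w s) * f (unit_vec s) t)"
      by (subst free_hom_expand[OF f w'_free]) (simp add: w'_def)
    also have "\<dots> = (\<Sum>s<length D. hom_part (d - E ! t) (w s * f (unit_vec s) t))"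
    proof (intro sum.cong refl)
      fix s assume "s \<in> {..<length D}"
      then show "hom_part (d - D ! s) (w s) * f (unit_vec s) t = hom_part (d - E ! t) (w s * f (unit_vec s) t)"
        using hom_part_mult[OF hom, of s "d - D ! s" "w s"] by simp
    qed
    also have "\<dots> = hom_part (d - E ! t) (f w t)"
      by (simp add: free_hom_expand[OF f w] hom_part_sum)
    also have "\<dots> = f w t"
      using fw True by (intro hom_part_homogeneous) (simp add: free_component_iff)
    finally show ?thesis .
  next
    case False
    then show ?thesis
      using free_homD(1)[OF f w] free_homD(1)[OF f w'_free] by (simp add: free_iff)
  qed
  then show ?thesis using w' by blast
qed

text \<open>Projectivity of graded free modules: homogeneous preimages of the basis vectors are
  chosen and extended linearly.\<close>

lemma free_hom_lift:
  assumes f: "f \<in> free_hom n D E" and p: "p \<in> free_hom n C E"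
    and im: "\<And>v. v \<in> free n D \<Longrightarrow> f v \<in> p ` free n C"
  obtains g where "g \<in> free_hom n D C" "\<And>v. v \<in> free n D \<Longrightarrow> p (g v) = f v"
proof -
  have "\<exists>w\<in>component (free_module n C) (D ! s). p w = f (unit_vec s)" if s: "s < length D" for s
  proof -
    obtain w where "w \<in> free n C" "p w = f (unit_vec s)"
      using im[OF unit_vec_free[OF s]] by (metis imageE)
    then show ?thesis
      using graded_preimage[OF p, of w "D ! s"] free_homD(4)[OF f unit_vec_component[OF s]] by auto
  qed
  then obtain M where M: "M s \<in> component (free_module n C) (D ! s)" "p (M s) = f (unit_vec s)"
    if "s < length D" for s by metis
  define g where "g = (\<lambda>v t. \<Sum>s<length D. v s * M s t)"
  have g: "g \<in> free_hom n D C" unfolding g_def by (rule free_hom_matrix) (rule M(1))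
  moreover have "p (g v) = f v" if v: "v \<in> free n D" for v
  proof -
    have M': "M s \<in> free n C" if "s < length D" for s using M(1)[OF that] by (simp add: free_component_iff)
    have "p (g v) = (\<lambda>t. \<Sum>s<length D. p (\<lambda>t. v s * M s t) t)"
      unfolding g_def using v M' by (intro free_hom_sum[OF p] free_smult) (auto simp: free_coord)
    also have "\<dots> = (\<lambda>t. \<Sum>s<length D. v s * f (unit_vec s) t)"
      using v M' M(2) by (intro ext sum.cong refl) (simp add: free_homD(3)[OF p] free_coord)
    also have "\<dots> = f v" using free_hom_expand[OF f v] by auto
    finally show ?thesis .
  qed
  ultimately show ?thesis using that by blast
qed

lemma free_hom_preserves_zero_constants:
  assumes f: "f \<in> free_hom n D E" and v: "v \<in> free n D" and "\<And>s. lookup (v s) 0 = 0"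
  shows "lookup (f v t) 0 = 0"
  by (simp add: free_hom_expand[OF f v] lookup_sum lookup_mult_0 assms(3))

lemma irrelevant_submodule_constant:
  assumes "v \<in> irrelevant_submodule n D"
  shows "lookup (v s) 0 = 0"
  using assms
  by (cases "s < length D") (auto simp: irrelevant_submodule_def free_iff intro: irrelevant_constant)

subsection \<open>Uniqueness of the degrees in a minimal resolution\<close>

text \<open>
  Embedding \<open>I\<close> into \<open>R = free_module n [0]\<close> makes all modules of an augmented resolution free, so
  that the augmentation needs no separate treatment: \<open>D 0\<close> is the degree list of \<open>R\<close>, and the
  \<open>i\<close>-th free module of the resolution has degree list \<open>D (Suc i)\<close>.
\<close>

definition augmented_resolution ::
  "nat \<Rightarrow> 'k::field mpoly set \<Rightarrow> (nat \<Rightarrow> int list) \<Rightarrow> (nat \<Rightarrow> (nat \<Rightarrow> 'k mpoly) \<Rightarrow> nat \<Rightarrow> 'k mpoly) \<Rightarrow> bool" where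
  "augmented_resolution n I D \<psi> \<longleftrightarrow>
     D 0 = [0] \<and>
     (\<forall>i. \<psi> i \<in> free_hom n (D (Suc i)) (D i)) \<and>
     \<psi> 0 ` free n (D 1) = {v \<in> free n [0]. v 0 \<in> I} \<and>
     (\<forall>i. \<psi> (Suc i) ` free n (D (Suc (Suc i))) = {v \<in> free n (D (Suc i)). \<psi> i v = (\<lambda>s. 0)}) \<and>
     (\<forall>i. \<psi> i ` free n (D (Suc i)) \<subseteq> irrelevant_submodule n (D i))"

text \<open>The comparison maps satisfy that \<open>b (a v) - v\<close> has zero constant
  coefficients, so modulo the irrelevant ideal \<open>b\<close> is a left inverse of
  \<open>a\<close>. Hence \<open>a\<close> maps each basis vector to a vector with a nonzero
  constant in some coordinate, and homogeneity forces the degree of that coordinate to be the degree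
  of the basis vector.\<close>

lemma augmented_resolution_degrees_subset:
  fixes I :: "'k::field mpoly set"
  assumes F: "augmented_resolution n I D \<psi>" and G: "augmented_resolution n I D' \<psi>'"
  shows "set (D i) \<subseteq> set (D' i)"
proof -
  note hom = F[unfolded augmented_resolution_def, THEN conjunct2, THEN conjunct1, rule_format]
    and hom' = G[unfolded augmented_resolution_def, THEN conjunct2, THEN conjunct1, rule_format]
  have ex: "\<psi> (Suc i) ` free n (D (Suc (Suc i))) = {v \<in> free n (D (Suc i)). \<psi> i v = (\<lambda>s. 0)}"
    and ex': "\<psi>' (Suc i) ` free n (D' (Suc (Suc i))) = {v \<in> free n (D' (Suc i)). \<psi>' i v = (\<lambda>s. 0)}" for i
    using F G by (auto simp: augmented_resolution_def)
  have cmplx: "\<psi> i (\<psi> (Suc i) v) = (\<lambda>s. 0)" if "v \<in> free n (D (Suc (Suc i)))" for i v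
    using that ex by blast
  have cmplx': "\<psi>' i (\<psi>' (Suc i) v) = (\<lambda>s. 0)" if "v \<in> free n (D' (Suc (Suc i)))" for i v
    using that ex' by blast
  have const: "lookup (\<psi> i v s) 0 = 0" if "v \<in> free n (D (Suc i))" for i v s
    using F that unfolding augmented_resolution_def
    by (intro irrelevant_submodule_constant[of _ n "D i"]) blast
  \<comment> \<open>The invariant holds what the next level needs. The two image conditions make
    lifting possible. The homotopy relation is asserted only on the image of
    \<open>\<psi> i\<close>, where the term that factors through the preceding differential
    vanishes, so that no homotopy from an earlier level occurs.\<close>
  have "\<exists>a b h. a \<in> free_hom n (D i) (D' i) \<and> b \<in> free_hom n (D' i) (D i) \<and> h \<in> free_hom n (D i) (D (Suc i))
      \<and> (\<forall>v\<in>free n (D (Suc i)). a (\<psi> i v) \<in> \<psi>' i ` free n (D' (Suc i)))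
      \<and> (\<forall>v\<in>free n (D' (Suc i)). b (\<psi>' i v) \<in> \<psi> i ` free n (D (Suc i)))
      \<and> (\<forall>v\<in>free n (D (Suc i)). \<psi> i (h (\<psi> i v)) = (\<lambda>s. b (a (\<psi> i v)) s - \<psi> i v s))
      \<and> (\<forall>v\<in>free n (D i). \<forall>s. lookup (b (a v) s - v s) 0 = 0)"
  proof (induction i)
    case 0
    have D: "D 0 = [0]" "D' 0 = [0]" and "\<psi> 0 ` free n (D 1) = {v \<in> free n [0]. v 0 \<in> I}"
      "\<psi>' 0 ` free n (D' 1) = {v \<in> free n [0]. v 0 \<in> I}"
      using F G by (auto simp: augmented_resolution_def)
    then have im: "\<psi> 0 ` free n (D (Suc 0)) = \<psi>' 0 ` free n (D' (Suc 0))" by simp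
    \<comment> \<open>In position 0 both modules are the ring and both differentials have the copy
      of \<open>I\<close> as image, so identities and the zero homotopy suffice.\<close>
    show ?case
      by (rule exI[of _ "\<lambda>v. v"], rule exI[of _ "\<lambda>v. v"], rule exI[of _ "\<lambda>v s. 0"])
        (use im in \<open>auto simp: D free_hom_id free_hom_zero_map free_hom_zero[OF hom]\<close>)
  next
    case (Suc i)
    then obtain a b h where a: "a \<in> free_hom n (D i) (D' i)" and b: "b \<in> free_hom n (D' i) (D i)"
      and h: "h \<in> free_hom n (D i) (D (Suc i))"
      and im_a: "\<And>v. v \<in> free n (D (Suc i)) \<Longrightarrow> a (\<psi> i v) \<in> \<psi>' i ` free n (D' (Suc i))"
      and im_b: "\<And>v. v \<in> free n (D' (Suc i)) \<Longrightarrow> b (\<psi>' i v) \<in> \<psi> i ` free n (D (Suc i))"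
      and htpy: "\<And>v. v \<in> free n (D (Suc i)) \<Longrightarrow> \<psi> i (h (\<psi> i v)) = (\<lambda>s. b (a (\<psi> i v)) s - \<psi> i v s)"
      by blast
    obtain a' where a': "a' \<in> free_hom n (D (Suc i)) (D' (Suc i))"
      and a'_lift: "\<And>v. v \<in> free n (D (Suc i)) \<Longrightarrow> \<psi>' i (a' v) = a (\<psi> i v)"
      using free_hom_lift[OF free_hom_comp[OF hom a] hom' im_a] by blast
    obtain b' where b': "b' \<in> free_hom n (D' (Suc i)) (D (Suc i))"
      and b'_lift: "\<And>v. v \<in> free n (D' (Suc i)) \<Longrightarrow> \<psi> i (b' v) = b (\<psi>' i v)"
      using free_hom_lift[OF free_hom_comp[OF hom' b] hom im_b] by blast
    \<comment> \<open>The part of \<open>b' \<circ> a' - id\<close> that the new homotopy must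
      account for. Applying \<open>\<psi> i\<close> turns \<open>b' (a' v)\<close> into
      \<open>b (a (\<psi> i v))\<close>, so the homotopy relation of the previous level says that
      \<open>c v\<close> is a cycle, hence a boundary.\<close>
    define c where "c = (\<lambda>v s. (b' (a' v) s - v s) - h (\<psi> i v) s)"
    have c: "c \<in> free_hom n (D (Suc i)) (D (Suc i))" unfolding c_def
      by (intro free_hom_minus free_hom_comp[OF a' b'] free_hom_comp[OF hom h] free_hom_id)
    have in_free: "a' v \<in> free n (D' (Suc i))" "b' (a' v) \<in> free n (D (Suc i))" "h (\<psi> i v) \<in> free n (D (Suc i))"
      if "v \<in> free n (D (Suc i))" for v
      using that by (auto intro!: free_homD(1)[OF a'] free_homD(1)[OF b'] free_homD(1)[OF h] free_homD(1)[OF hom])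
    have "c v \<in> \<psi> (Suc i) ` free n (D (Suc (Suc i)))" if v: "v \<in> free n (D (Suc i))" for v
    proof -
      have "\<psi> i (c v) = (\<lambda>s. (\<psi> i (b' (a' v)) s - \<psi> i v s) - \<psi> i (h (\<psi> i v)) s)"
        unfolding c_def using in_free v by (simp add: free_hom_diff[OF hom])
      also have "\<dots> = (\<lambda>s. 0)"
        using in_free v by (simp add: b'_lift a'_lift htpy)
      finally show ?thesis unfolding ex using free_homD(1)[OF c v] by simp
    qed
    then obtain h' where h': "h' \<in> free_hom n (D (Suc i)) (D (Suc (Suc i)))"
      and h'_lift: "\<And>v. v \<in> free n (D (Suc i)) \<Longrightarrow> \<psi> (Suc i) (h' v) = c v"
      using free_hom_lift[OF c hom] by blast
    have im: "\<psi> (Suc i) v \<in> free n (D (Suc i))" if "v \<in> free n (D (Suc (Suc i)))" for v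
      using free_homD(1)[OF hom that] .
    have im': "\<psi>' (Suc i) v \<in> free n (D' (Suc i))" if "v \<in> free n (D' (Suc (Suc i)))" for v
      using free_homD(1)[OF hom' that] .
    show ?case
    proof (intro exI conjI ballI allI)
      show "a' (\<psi> (Suc i) v) \<in> \<psi>' (Suc i) ` free n (D' (Suc (Suc i)))"
        if "v \<in> free n (D (Suc (Suc i)))" for v
        unfolding ex' using that im in_free
        by (auto simp: a'_lift cmplx free_hom_zero[OF a])
      show "b' (\<psi>' (Suc i) v) \<in> \<psi> (Suc i) ` free n (D (Suc (Suc i)))"
        if "v \<in> free n (D' (Suc (Suc i)))" for v
        unfolding ex using that im' free_homD(1)[OF b']
        by (auto simp: b'_lift cmplx' free_hom_zero[OF b])
      show "\<psi> (Suc i) (h' (\<psi> (Suc i) v)) = (\<lambda>s. b' (a' (\<psi> (Suc i) v)) s - \<psi> (Suc i) v s)"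
        if "v \<in> free n (D (Suc (Suc i)))" for v
        using that im by (simp add: h'_lift c_def cmplx free_hom_zero[OF h])
      show "lookup (b' (a' v) s - v s) 0 = 0" if v: "v \<in> free n (D (Suc i))" for v s
      proof -
        \<comment> \<open>Minimality kills the constants of both summands: the first lies in the
          image of a differential, the second is \<open>h\<close> applied to such an image, and a
          linear map creates no constants out of vectors that have none.\<close>
        have "b' (a' v) s - v s = \<psi> (Suc i) (h' v) s + h (\<psi> i v) s"
          by (simp add: h'_lift v c_def)
        moreover have "lookup (\<psi> (Suc i) (h' v) s) 0 = 0"
          using v by (intro const free_homD(1)[OF h'])
        moreover have "lookup (h (\<psi> i v) s) 0 = 0"
          using v by (intro free_hom_preserves_zero_constants[OF h] free_homD(1)[OF hom] const)
        ultimately show ?thesis by (simp add: lookup_add)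
      qed
    qed (fact a' b' h')+
  qed
  then obtain a b :: "(nat \<Rightarrow> 'k mpoly) \<Rightarrow> nat \<Rightarrow> 'k mpoly"
    where a: "a \<in> free_hom n (D i) (D' i)" and b: "b \<in> free_hom n (D' i) (D i)"
    and const_ba: "\<forall>v\<in>free n (D i). \<forall>s. lookup (b (a v) s - v s) 0 = 0"
    by (elim exE conjE) (rule that)
  show ?thesis
  proof
    fix d assume "d \<in> set (D i)"
    then obtain s where s: "s < length (D i)" "d = D i ! s" by (metis in_set_conv_nth)
    let ?u = "unit_vec s :: nat \<Rightarrow> 'k mpoly"
    have au: "a ?u \<in> component (free_module n (D' i)) d"
      using free_homD(4)[OF a unit_vec_component[OF s(1)]] s(2) by simp
    then have au': "a ?u \<in> free n (D' i)" by (simp add: free_component_iff)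
    have "lookup (b (a ?u) s) 0 = 1"
      using bspec[OF const_ba unit_vec_free[OF s(1)], THEN spec, of s] by (simp add: unit_vec_def lookup_minus)
    \<comment> \<open>The constant 1 is the diagonal entry at \<open>s\<close> of the product of the
      two reduced matrices; some summand must be nonzero.\<close>
    then have "(\<Sum>t<length (D' i). lookup (a ?u t) 0 * lookup (b (unit_vec t) s) 0) \<noteq> 0"
      by (simp add: free_hom_expand[OF b au'] lookup_sum lookup_mult_0)
    then obtain t where t: "t < length (D' i)" "lookup (a ?u t) 0 \<noteq> 0"
      by (auto elim!: sum.not_neutral_contains_not_neutral)
    then have "d = D' i ! t"
    proof -
      have "homogeneous (d - D' i ! t) (a ?u t)" using au t(1) by (simp add: free_component_iff)
      moreover have "0 \<in> keys (a ?u t)" using t(2) by (simp add: in_keys_iff)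
      ultimately have "int (total_degree 0) = d - D' i ! t" unfolding homogeneous_def by blast
      then show ?thesis by (simp add: total_degree_def)
    qed
    then show "d \<in> set (D' i)" using t by simp
  qed
qed

lemma augmented_resolution_degrees_eq:
  assumes "augmented_resolution n I D \<psi>" "augmented_resolution n I D' \<psi>'"
  shows "set (D i) = set (D' i)"
  using augmented_resolution_degrees_subset[OF assms] augmented_resolution_degrees_subset[OF assms(2,1)]
  by blast

section \<open>Passing between resolutions of an ideal and augmented resolutions\<close>

lemma ideal_module_simps [simp]:
  "carrier (ideal_module I) = I" "ring.zero (ideal_module I) = 0" "ring.add (ideal_module I) = (+)"
  "module.smult (ideal_module I) = (*)" "component (ideal_module I) d = {p \<in> I. homogeneous d p}"
  by (simp_all add: ideal_module_def)

lemma a_kernel_free: "a_kernel (free_module n D) N f = {v \<in> free n D. f v = \<zero>\<^bsub>N\<^esub>}"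
  by (simp add: a_kernel_def kernel_def)

lemma free_rank_1_iff: "v \<in> free n [d] \<longleftrightarrow> (\<exists>p\<in>mpolys n. v = (\<lambda>s. if s = 0 then p else 0))"
  by (auto simp: free_iff fun_eq_iff)

text \<open>\<open>case_nat\<close> shifts all indices by one to make room for the ring. Minimality
  at the new position says that the image of the augmentation, which is \<open>I\<close>, lies in
  the irrelevant ideal; this is why \<open>I\<close> must be contained in it.\<close>

lemma augmented_resolution_of_min_graded_free_resolution:
  assumes res: "min_graded_free_resolution n I D e \<phi>" and I: "I \<subseteq> irrelevant_ideal n" "I \<subseteq> mpolys n"
  shows "augmented_resolution n I (case_nat [0] D) (case_nat (\<lambda>v s. if s = 0 then e v else 0) \<phi>)"
proof -
  let ?e = "\<lambda>v s. if s = 0 then e v else 0"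
  have e: "e \<in> graded_hom (mpoly_ring n) (free_module n (D 0)) (ideal_module I)"
    and im_e: "e ` free n (D 0) = I"
    using res by (auto simp: min_graded_free_resolution_def)
  have e_I: "e v \<in> I" if "v \<in> free n (D 0)" for v using that im_e by blast
  have e_comp: "homogeneous d (e v)" if "v \<in> component (free_module n (D 0)) d" for v d
    using that e by (auto simp: graded_hom_def image_subset_iff)
  have e_hom: "?e \<in> free_hom n (D 0) [0]"
  proof (rule free_homI)
    show "?e v \<in> component (free_module n [0]) d" if "v \<in> component (free_module n (D 0)) d" for v d
      using e_comp[OF that] that e_I I(2) by (auto simp: free_component_iff[of _ _ "[0]"] free_component_iff[of _ _ "D 0"] free_iff[of _ _ "[0]"])
  qed (use e I e_I in \<open>auto simp: graded_hom_def fun_eq_iff free_iff\<close>)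
  have im: "?e ` free n (D 0) = {v \<in> free n [0]. v 0 \<in> I}"
    using I e_I unfolding im_e[symmetric] by (fastforce simp: free_rank_1_iff)
  have ker: "\<phi> 0 ` free n (D 1) = {v \<in> free n (D 0). ?e v = (\<lambda>s. 0)}"
    using res by (auto simp: min_graded_free_resolution_def a_kernel_free fun_eq_iff)
  have min: "?e ` free n (D 0) \<subseteq> irrelevant_submodule n [0]"
    using I by (auto simp: im irrelevant_submodule_def)
  show ?thesis
    unfolding augmented_resolution_def using res e_hom im ker min
    by (auto simp: min_graded_free_resolution_def a_kernel_free split: nat.split)
qed

lemma min_graded_free_resolution_of_augmented_resolution:
  assumes res: "augmented_resolution n I D \<psi>" and I: "I \<subseteq> mpolys n"
  shows "min_graded_free_resolution n I (\<lambda>i. D (Suc i)) (\<lambda>v. \<psi> 0 v 0) (\<lambda>i. \<psi> (Suc i))"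
proof -
  have D: "D 0 = [0]" and hom: "\<psi> i \<in> free_hom n (D (Suc i)) (D i)"
    and im: "\<psi> 0 ` free n (D 1) = {v \<in> free n [0]. v 0 \<in> I}" for i
    using res by (auto simp: augmented_resolution_def)
  have im0: "(\<lambda>v. \<psi> 0 v 0) ` free n (D 1) = I"
  proof -
    have "(\<lambda>v. \<psi> 0 v 0) ` free n (D 1) = (\<lambda>v. v 0) ` {v \<in> free n [0]. v 0 \<in> I}"
      unfolding im[symmetric] by (simp add: image_image)
    also have "\<dots> = I"
      using I by (force simp: free_iff intro!: image_eqI[of _ _ "\<lambda>s. if s = 0 then p else 0" for p])
    finally show ?thesis .
  qed
  have zero: "\<psi> 0 v = (\<lambda>s. 0) \<longleftrightarrow> \<psi> 0 v 0 = 0" if "v \<in> free n (D (Suc 0))" for v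
  proof -
    have "\<psi> 0 v s = 0" if "s \<noteq> 0" for s
      using free_homD(1)[OF hom \<open>v \<in> free n (D (Suc 0))\<close>] that by (simp add: D free_iff)
    then have "\<psi> 0 v 0 = 0 \<Longrightarrow> \<psi> 0 v s = 0" for s by (cases "s = 0") auto
    then show ?thesis by auto
  qed
  have exact: "\<psi> (Suc i) ` free n (D (Suc (Suc i))) = {v \<in> free n (D (Suc i)). \<psi> i v = (\<lambda>s. 0)}" for i
    using res by (simp add: augmented_resolution_def)
  show ?thesis
    unfolding min_graded_free_resolution_def
  proof (intro conjI allI)
    show "(\<lambda>v. \<psi> 0 v 0) \<in> graded_hom (mpoly_ring n) (free_module n (D (Suc 0))) (ideal_module I)"
      unfolding graded_hom_def using im0 free_homD[OF hom[of 0]]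
      by (auto simp: D free_component_iff)
    show "\<psi> (Suc 0) ` free n (D (Suc 1)) = a_kernel (free_module n (D (Suc 0))) (ideal_module I) (\<lambda>v. \<psi> 0 v 0)"
      using exact[of 0] zero by (auto simp: a_kernel_free)
    show "\<psi> (Suc i) ` free n (D (Suc (Suc i))) \<subseteq> irrelevant_submodule n (D (Suc i))" for i
      using res unfolding augmented_resolution_def by blast
  qed (use hom im0 exact in \<open>simp_all add: a_kernel_free\<close>)
qed

subsection \<open>The Taylor complex of a squarefree monomial ideal\<close>

definition squarefree_exp :: "nat set \<Rightarrow> (nat \<Rightarrow>\<^sub>0 nat)" where
  "squarefree_exp B = (\<Sum>i\<in>B. Poly_Mapping.single i 1)"

lemma lookup_squarefree_exp: "finite B \<Longrightarrow> lookup (squarefree_exp B) i = (if i \<in> B then 1 else 0)"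
  by (simp add: squarefree_exp_def lookup_sum lookup_single when_def)

lemma keys_squarefree_exp: "finite B \<Longrightarrow> keys (squarefree_exp B) = B"
  by (simp add: set_eq_iff in_keys_iff lookup_squarefree_exp)

lemma total_degree_squarefree_exp: "finite B \<Longrightarrow> total_degree (squarefree_exp B) = card B"
  by (simp add: total_degree_def keys_squarefree_exp lookup_squarefree_exp)

lemma squarefree_exp_empty [simp]: "squarefree_exp {} = 0"
  by (simp add: squarefree_exp_def)

lemma squarefree_exp_Un_disjoint:
  "finite B \<Longrightarrow> finite C \<Longrightarrow> B \<inter> C = {} \<Longrightarrow> squarefree_exp (B \<union> C) = squarefree_exp B + squarefree_exp C"
  by (simp add: squarefree_exp_def sum.union_disjoint)

text \<open>Divisibility by a squarefree monomial depends only on the support; this is what lets the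
  generators dividing a monomial be described by sets.\<close>

lemma squarefree_exp_le_iff:
  assumes "finite B"
  shows "(\<exists>s. t = squarefree_exp B + s) \<longleftrightarrow> B \<subseteq> keys t"
proof
  assume "B \<subseteq> keys t"
  then have "t = squarefree_exp B + (t - squarefree_exp B)"
    using assms
    by (intro poly_mapping_eqI) (auto simp: lookup_add lookup_minus lookup_squarefree_exp in_keys_iff Suc_le_eq)
  then show "\<exists>s. t = squarefree_exp B + s" ..
next
  assume "\<exists>s. t = squarefree_exp B + s"
  then show "B \<subseteq> keys t"
    using assms by (auto simp: keys_add_nat keys_squarefree_exp)
qed

lemma squarefree_exp_diff_add:
  assumes "finite B" "B \<subseteq> keys t"
  shows "t - squarefree_exp B + squarefree_exp B = t"
  using assms
  by (intro poly_mapping_eqI) (auto simp: lookup_add lookup_minus lookup_squarefree_exp in_keys_iff Suc_le_eq)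

text \<open>\<open>A j\<close> is the support of the \<open>j\<close>-th generator. The private
  variable of a generator is used twice: it keeps units out of the Taylor matrices, and it bounds
  from below how much the lcm grows with the set of generators.\<close>

locale squarefree_ideal =
  fixes n :: nat and J :: "nat set" and A :: "nat \<Rightarrow> nat set"
  assumes finite_J: "finite J"
    and A_subset: "j \<in> J \<Longrightarrow> A j \<subseteq> {1..n}"
    and private_element: "j \<in> J \<Longrightarrow> \<exists>x\<in>A j. \<forall>i\<in>J - {j}. x \<notin> A i"
begin

definition cover :: "nat set \<Rightarrow> nat set" where
  "cover S = \<Union> (A ` S)"

text \<open>The index counts generators, so \<open>faces (Suc i)\<close> belongs to homological
  degree \<open>i\<close> of the ideal, and \<open>faces 0\<close> to the ring.\<close>

definition faces :: "nat \<Rightarrow> nat set set" where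
  "faces p = {S. S \<subseteq> J \<and> card S = p}"

definition face_list :: "nat \<Rightarrow> nat set list" where
  "face_list p = (SOME xs. distinct xs \<and> set xs = faces p)"

definition taylor_degrees :: "nat \<Rightarrow> int list" where
  "taylor_degrees p = map (\<lambda>S. int (card (cover S))) (face_list p)"

text \<open>For \<open>j\<close> outside \<open>S\<close>, the sign of the face \<open>S\<close> in
  the simplicial boundary of \<open>insert j S\<close>, with vertices listed in increasing
  order.\<close>

definition taylor_sign :: "nat \<Rightarrow> nat set \<Rightarrow> 'k::field" where
  "taylor_sign j S = (-1) ^ card {i\<in>S. i < j}"

text \<open>The basis of the \<open>p\<close>-th module is indexed by \<open>faces p\<close>, in the order given by \<open>face_list p\<close>.
  The index includes the augmentation: \<open>p = 0\<close> is the ring itself.\<close>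

definition vec :: "nat \<Rightarrow> (nat set \<Rightarrow> 'k::field mpoly) \<Rightarrow> nat \<Rightarrow> 'k mpoly" where
  "vec p V = (\<lambda>s. if s < length (face_list p) then V (face_list p ! s) else 0)"

text \<open>At most one \<open>j\<close> contributes, so the entry is 0 or, up to sign, the monomial
  lcm of \<open>T\<close> divided by lcm of \<open>S\<close>. The sum avoids having to select that
  \<open>j\<close>.\<close>

definition taylor_coeff :: "nat set \<Rightarrow> nat set \<Rightarrow> 'k::field mpoly" where
  "taylor_coeff S T =
     (\<Sum>j\<in>J - S. if insert j S = T then Poly_Mapping.single (squarefree_exp (A j - cover S)) (taylor_sign j S) else 0)"

definition taylor_map :: "nat \<Rightarrow> (nat \<Rightarrow> 'k::field mpoly) \<Rightarrow> nat \<Rightarrow> 'k mpoly" where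
  "taylor_map p v = (\<lambda>t. \<Sum>s<length (taylor_degrees (Suc p)).
     v s * vec p (\<lambda>S. taylor_coeff S (face_list (Suc p) ! s)) t)"

text \<open>The same differential as \<open>taylor_map\<close>, in coordinates indexed by sets
  instead of list positions. The coordinate at \<open>S\<close> collects contributions from the
  faces that have one more vertex.\<close>

definition taylor_diff :: "(nat set \<Rightarrow> 'k::field mpoly) \<Rightarrow> nat set \<Rightarrow> 'k mpoly" where
  "taylor_diff V S =
     (\<Sum>j\<in>J - S. Poly_Mapping.single (squarefree_exp (A j - cover S)) (taylor_sign j S) * V (insert j S))"

lemma finite_face: "S \<subseteq> J \<Longrightarrow> finite S"
  using finite_J by (rule rev_finite_subset)

lemma finite_A: "j \<in> J \<Longrightarrow> finite (A j)"
  using A_subset by (rule finite_subset) auto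

lemma finite_cover: "S \<subseteq> J \<Longrightarrow> finite (cover S)"
  by (auto simp: cover_def finite_face intro!: finite_A)

lemma cover_insert [simp]: "cover (insert j S) = A j \<union> cover S"
  by (simp add: cover_def)

lemma face_list: "distinct (face_list p)" "set (face_list p) = faces p"
proof -
  have "finite (faces p)"
    by (rule finite_subset[of _ "Pow J"]) (auto simp: faces_def finite_J)
  from finite_distinct_list[OF this] have "\<exists>xs. distinct xs \<and> set xs = faces p"
    by (simp only: conj_commute)
  then have "distinct (face_list p) \<and> set (face_list p) = faces p"
    unfolding face_list_def by (rule someI_ex)
  then show "distinct (face_list p)" "set (face_list p) = faces p" by auto
qed

lemma face_nth: "s < length (face_list p) \<Longrightarrow> face_list p ! s \<in> faces p"
  using face_list(2) nth_mem by blast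

lemma insert_in_faces: "S \<in> faces p \<Longrightarrow> j \<in> J - S \<Longrightarrow> insert j S \<in> faces (Suc p)"
  by (auto simp: faces_def finite_face)

lemma face_list_0: "face_list 0 = [{}]"
proof -
  have "faces 0 = {{}}" by (auto simp: faces_def finite_face)
  then have "set (face_list 0) = {{}}" "length (face_list 0) = 1"
    using face_list[of 0] distinct_card[of "face_list 0"] by auto
  then show ?thesis by (cases "face_list 0") auto
qed

lemma length_taylor_degrees [simp]: "length (taylor_degrees p) = length (face_list p)"
  by (simp add: taylor_degrees_def)

lemma vec_free: "(\<And>S. S \<in> faces p \<Longrightarrow> V S \<in> mpolys n) \<Longrightarrow> vec p V \<in> free n (taylor_degrees p)"
  by (auto simp: free_iff vec_def face_nth)

lemma vec_eq_iff: "vec p V = vec p W \<longleftrightarrow> (\<forall>S\<in>faces p. V S = W S)"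
  by (auto simp: fun_eq_iff vec_def all_set_conv_all_nth simp flip: face_list(2))

lemma vec_zero: "vec p (\<lambda>S. 0) = (\<lambda>s. 0)"
  by (simp add: vec_def)

lemma free_obtain_vec:
  assumes "v \<in> free n (taylor_degrees p)"
  obtains V where "v = vec p V" "\<And>S. V S \<in> mpolys n"
proof -
  \<comment> \<open>Positions in \<open>face_list p\<close> are distinct, so at most one summand is
    nonzero. At sets that are not faces \<open>V\<close> is 0, hence \<open>V S\<close> is a
    polynomial in the right variables for every \<open>S\<close>, as
    \<open>taylor_cone_in_mpolys\<close> demands.\<close>
  define V where "V S = (\<Sum>s<length (face_list p). if face_list p ! s = S then v s else 0)" for S
  have "V (face_list p ! s) = v s" if "s < length (face_list p)" for s
  proof -
    have "V (face_list p ! s) = (\<Sum>t<length (face_list p). if t = s then v s else 0)"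
      unfolding V_def using that face_list(1) by (intro sum.cong) (auto simp: nth_eq_iff_index_eq)
    then show ?thesis using that by simp
  qed
  then have "v = vec p V" using assms by (auto simp: vec_def fun_eq_iff free_iff)
  moreover have "V S \<in> mpolys n" for S
    unfolding V_def using assms by (intro mpolys_sum) (auto simp: free_coord)
  ultimately show ?thesis using that by blast
qed

lemma taylor_map_vec: "taylor_map p (vec (Suc p) V) = vec p (taylor_diff V)"
proof
  fix t
  show "taylor_map p (vec (Suc p) V) t = vec p (taylor_diff V) t"
  proof (cases "t < length (face_list p)")
    case True
    let ?c = "\<lambda>j S. Poly_Mapping.single (squarefree_exp (A j - cover S)) (taylor_sign j S) :: 'a mpoly"
    define S where "S = face_list p ! t"
    have S: "S \<in> faces p" unfolding S_def using True by (rule face_nth)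
    let ?L = "face_list (Suc p)"
    have "taylor_map p (vec (Suc p) V) t = (\<Sum>s<length ?L. V (?L ! s) * taylor_coeff S (?L ! s))"
      using True by (simp add: taylor_map_def vec_def S_def)
    also have "\<dots> = (\<Sum>T\<in>faces (Suc p). V T * taylor_coeff S T)"
      using sum.reindex_bij_betw[OF bij_betw_nth[OF face_list(1) refl refl], of "\<lambda>T. V T * taylor_coeff S T" "Suc p"]
      by (simp add: face_list(2))
    also have "\<dots> = (\<Sum>T\<in>faces (Suc p). \<Sum>j\<in>J - S. if T = insert j S then ?c j S * V T else 0)"
      unfolding taylor_coeff_def sum_distrib_left by (intro sum.cong refl) auto
    also have "\<dots> = (\<Sum>j\<in>J - S. \<Sum>T\<in>faces (Suc p). if T = insert j S then ?c j S * V T else 0)"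
      by (rule sum.swap)
    also have "\<dots> = (\<Sum>j\<in>J - S. ?c j S * V (insert j S))"
    proof (intro sum.cong refl)
      fix j assume "j \<in> J - S"
      with S have "insert j S \<in> faces (Suc p)" by (rule insert_in_faces)
      moreover have "finite (faces (Suc p))" by (simp flip: face_list(2))
      ultimately show "(\<Sum>T\<in>faces (Suc p). if T = insert j S then ?c j S * V T else 0) = ?c j S * V (insert j S)"
        by (simp add: sum.delta)
    qed
    also have "\<dots> = vec p (taylor_diff V) t"
      using True by (simp add: vec_def taylor_diff_def S_def)
    finally show ?thesis .
  qed (simp add: taylor_map_def vec_def)
qed

lemma taylor_coeff_cases:
  assumes "S \<in> faces p" "T \<in> faces q"
  shows "(taylor_coeff S T :: 'k::field mpoly) \<in> mpolys n"
    and "homogeneous (int (card (cover T)) - int (card (cover S))) (taylor_coeff S T :: 'k mpoly)"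
    and "(taylor_coeff S T :: 'k::field mpoly) \<in> irrelevant_ideal n"
proof -
  have S: "S \<subseteq> J" using assms by (auto simp: faces_def)
  let ?E = "\<lambda>j. squarefree_exp (A j - cover S)"
  have fin: "finite (A j - cover S)" and keys: "keys (?E j) \<subseteq> {1..n}" if "j \<in> J - S" for j
    using that finite_A[of j] A_subset[of j] by (auto simp: keys_squarefree_exp)
  have "?E j \<noteq> 0" if "j \<in> J - S" for j
  proof -
    \<comment> \<open>The private variable of \<open>j\<close> divides no generator in
      \<open>S\<close>, so it survives in \<open>A j - cover S\<close> and the coefficient is not a
      constant.\<close>
    obtain x where x: "x \<in> A j" "\<forall>i\<in>J - {j}. x \<notin> A i"
      using private_element \<open>j \<in> J - S\<close> by blast
    have "x \<notin> A i" if "i \<in> S" for i using x(2) that S \<open>j \<in> J - S\<close> by auto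
    then have "A j - cover S \<noteq> {}" using x(1) by (auto simp: cover_def)
    then have "keys (?E j) \<noteq> {}" using fin[OF that] by (simp add: keys_squarefree_exp)
    then show ?thesis by auto
  qed
  then have "Poly_Mapping.single (?E j) c \<in> irrelevant_ideal n" if "j \<in> J - S" for j and c ::'k
    using keys that by (intro monomial_in_irrelevant)
  then show "(taylor_coeff S T :: 'k mpoly) \<in> irrelevant_ideal n"
    unfolding taylor_coeff_def
    by (intro ideal_mpoly_ring_sum[OF ideal_irrelevant]) (simp add: ideal_mpoly_ringD(2)[OF ideal_irrelevant])
  then show "(taylor_coeff S T :: 'k mpoly) \<in> mpolys n"
    using ideal_mpoly_ringD(1)[OF ideal_irrelevant] by blast
  show "homogeneous (int (card (cover T)) - int (card (cover S))) (taylor_coeff S T :: 'k mpoly)"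
    unfolding taylor_coeff_def
  proof (intro homogeneous_sum)
    fix j assume j: "j \<in> J - S"
    have "int (total_degree (?E j)) = int (card (cover T)) - int (card (cover S))" if "insert j S = T"
    proof -
      have "cover T = (A j - cover S) \<union> cover S" using that by auto
      then have "card (cover T) = card (A j - cover S) + card (cover S)"
        using fin[OF j] finite_cover[OF S] by (simp only:) (rule card_Un_disjoint, auto)
      then show ?thesis using fin[OF j] by (simp add: total_degree_squarefree_exp)
    qed
    then show "homogeneous (int (card (cover T)) - int (card (cover S)))
      (if insert j S = T then Poly_Mapping.single (?E j) (taylor_sign j S) else (0 :: 'k mpoly))"
      by (auto intro: homogeneous_single)
  qed
qed

lemma taylor_map_hom: "taylor_map p \<in> free_hom n (taylor_degrees (Suc p)) (taylor_degrees p)"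
  unfolding taylor_map_def
proof (rule free_hom_matrix)
  fix s assume "s < length (taylor_degrees (Suc p))"
  then show "vec p (\<lambda>S. taylor_coeff S (face_list (Suc p) ! s)) \<in>
    component (free_module n (taylor_degrees p)) (taylor_degrees (Suc p) ! s)"
    by (auto simp: free_component_iff free_iff vec_def taylor_degrees_def
        intro!: taylor_coeff_cases dest: face_nth)
qed

lemma taylor_map_minimal:
  assumes "v \<in> free n (taylor_degrees (Suc p))"
  shows "taylor_map p v \<in> irrelevant_submodule n (taylor_degrees p)"
proof -
  have "taylor_map p v t \<in> irrelevant_ideal n" for t
    unfolding taylor_map_def
  proof (intro ideal_mpoly_ring_sum[OF ideal_irrelevant] ideal_mpoly_ringD(4)[OF ideal_irrelevant])
    fix s assume "s \<in> {..<length (taylor_degrees (Suc p))}"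
    then show "vec p (\<lambda>S. taylor_coeff S (face_list (Suc p) ! s)) t \<in> irrelevant_ideal n"
      by (auto simp: vec_def ideal_mpoly_ringD(2)[OF ideal_irrelevant] intro!: taylor_coeff_cases dest: face_nth)
  qed (use assms in \<open>auto simp: free_coord\<close>)
  then show ?thesis
    using free_homD(1)[OF taylor_map_hom assms] by (simp add: irrelevant_submodule_def)
qed

lemma taylor_sign_insert:
  assumes "i \<notin> S" "finite S"
  shows "taylor_sign j (insert i S) = (if i < j then - taylor_sign j S else taylor_sign j S)"
proof -
  have "{x \<in> insert i S. x < j} = (if i < j then insert i {x\<in>S. x < j} else {x\<in>S. x < j})" by auto
  then show ?thesis using assms by (simp add: taylor_sign_def)
qed

text \<open>Adding \<open>j\<close> and \<open>i\<close> to \<open>S\<close> in either order gives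
  the same monomial, but the two signs are opposite. The pairs with \<open>j < i\<close> therefore
  cancel against their transposes.\<close>

lemma taylor_diff_diff:
  assumes S: "S \<subseteq> J"
  shows "taylor_diff (taylor_diff V) S = 0"
proof -
  define g where "g j i = Poly_Mapping.single (squarefree_exp (A j \<union> A i - cover S))
    (taylor_sign j S * taylor_sign i (insert j S)) * V (insert i (insert j S))" for j i
  define P where "P = {(j, i). j \<in> J - S \<and> i \<in> J - S \<and> j < i}"
  define Q where "Q = {(j, i). j \<in> J - S \<and> i \<in> J - S \<and> i < j}"
  have "finite ((J - S) \<times> (J - S))" using finite_J by simp
  then have fin: "finite P" "finite Q" by (auto simp: P_def Q_def elim!: rev_finite_subset)
  have "taylor_diff (taylor_diff V) S = (\<Sum>j\<in>J - S. \<Sum>i\<in>J - insert j S. g j i)"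
    unfolding taylor_diff_def
  proof (intro sum.cong refl)
    fix j assume j: "j \<in> J - S"
    let ?c = "\<lambda>j S. Poly_Mapping.single (squarefree_exp (A j - cover S)) (taylor_sign j S) :: 'a mpoly"
    have "?c j S * (?c i (insert j S) * V (insert i (insert j S))) = g j i" if i: "i \<in> J - insert j S" for i
    proof -
      have "squarefree_exp ((A j - cover S) \<union> (A i - cover (insert j S)))
          = squarefree_exp (A j - cover S) + squarefree_exp (A i - cover (insert j S))"
        using i j by (intro squarefree_exp_Un_disjoint) (auto simp: finite_A)
      moreover have "(A j - cover S) \<union> (A i - cover (insert j S)) = A j \<union> A i - cover S" by auto
      ultimately show ?thesis by (simp add: g_def mult_single flip: mult.assoc)
    qed
    then show "?c j S * (\<Sum>i\<in>J - insert j S. ?c i (insert j S) * V (insert i (insert j S)))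
        = (\<Sum>i\<in>J - insert j S. g j i)"
      by (simp add: sum_distrib_left)
  qed
  also have "\<dots> = (\<Sum>(j, i)\<in>P \<union> Q. g j i)"
  proof -
    have "P \<union> Q = (SIGMA j:J - S. J - insert j S)" by (auto simp: P_def Q_def)
    then show ?thesis using finite_J by (simp add: sum.Sigma)
  qed
  also have "\<dots> = (\<Sum>(j, i)\<in>P. g j i) + (\<Sum>(j, i)\<in>Q. g j i)"
  proof (rule sum.union_disjoint[OF fin])
    show "P \<inter> Q = {}" unfolding P_def Q_def by fastforce
  qed
  also have "(\<Sum>(j, i)\<in>Q. g j i) = (\<Sum>(j, i)\<in>P. g i j)"
    by (rule sum.reindex_bij_witness[of _ "\<lambda>(j, i). (i, j)" "\<lambda>(j, i). (i, j)"]) (auto simp: P_def Q_def)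
  also have "(\<Sum>(j, i)\<in>P. g j i) + (\<Sum>(j, i)\<in>P. g i j) = (\<Sum>(j, i)\<in>P. g j i + g i j)"
    by (simp add: sum.distrib case_prod_unfold)
  also have "\<dots> = 0"
  proof (intro sum.neutral ballI)
    fix x assume "x \<in> P"
    then obtain j i where x: "x = (j, i)" and ji: "j \<in> J - S" "i \<in> J - S" "j < i" by (auto simp: P_def)
    then have "taylor_sign j S * taylor_sign i (insert j S) = - (taylor_sign i S * taylor_sign j (insert i S) :: 'a)"
      using finite_face[OF S] by (simp add: taylor_sign_insert)
    then show "(case x of (j, i) \<Rightarrow> g j i + g i j) = 0"
      by (simp add: x g_def Un_commute[of "A i"] insert_commute[of i] single_uminus)
  qed
  finally show ?thesis .
qed

text \<open>
  The strand of the Taylor complex in multidegree \<open>T\<close> is the simplicial chain complex of the full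
  simplex on \<open>divisors T\<close>, the generators dividing the monomial with exponent \<open>T\<close>; coning from the
  least vertex of that simplex contracts it. A coefficient \<open>x\<^sup>t e\<^sub>S\<close> has multidegree
  \<open>T = t + squarefree_exp (cover S)\<close>.
\<close>

definition divisors :: "(nat \<Rightarrow>\<^sub>0 nat) \<Rightarrow> nat set" where
  "divisors T = {j\<in>J. A j \<subseteq> keys T}"

definition strand :: "(nat set \<Rightarrow> 'k::field mpoly) \<Rightarrow> (nat \<Rightarrow>\<^sub>0 nat) \<Rightarrow> nat set \<Rightarrow> 'k" where
  "strand V T S = lookup (V S) (T - squarefree_exp (cover S))"

definition taylor_cone_coeff :: "(nat set \<Rightarrow> 'k::field mpoly) \<Rightarrow> nat set \<Rightarrow> (nat \<Rightarrow>\<^sub>0 nat) \<Rightarrow> 'k" where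
  "taylor_cone_coeff V S t = (let T = t + squarefree_exp (cover S); j = Min (divisors T)
     in if j \<in> S then strand V T (S - {j}) else 0)"

definition taylor_cone :: "(nat set \<Rightarrow> 'k::field mpoly) \<Rightarrow> nat set \<Rightarrow> 'k mpoly" where
  "taylor_cone V S = Abs_poly_mapping (taylor_cone_coeff V S)"

lemma finite_divisors: "finite (divisors T)"
  using finite_J by (simp add: divisors_def)

lemma subset_divisors: "S \<subseteq> J \<Longrightarrow> cover S \<subseteq> keys T \<Longrightarrow> S \<subseteq> divisors T"
  by (auto simp: divisors_def cover_def)

lemma cover_subset_keys: "S \<subseteq> divisors T \<Longrightarrow> cover S \<subseteq> keys T"
  by (auto simp: divisors_def cover_def)

text \<open>For a smaller set the truncated subtraction is really an addition of the missing
  variables. The exponent read by the cone is thus an injective translate of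
  \<open>t\<close>.\<close>

lemma shift_subset:
  assumes S: "S \<subseteq> J" and S': "S' \<subseteq> S"
  shows "t + squarefree_exp (cover S) - squarefree_exp (cover S') = t + squarefree_exp (cover S - cover S')"
proof -
  have "cover S' \<subseteq> cover S" using S' by (auto simp: cover_def)
  then show ?thesis
    using finite_cover[OF S] finite_cover[of S'] S S'
    by (intro poly_mapping_eqI) (auto simp: lookup_add lookup_minus lookup_squarefree_exp)
qed

text \<open>The cone vertex depends on \<open>t\<close>, but only vertices in \<open>S\<close> give
  nonzero coefficients. Finite support follows as a finite union of preimages of finite supports
  under injective translations.\<close>

lemma lookup_taylor_cone:
  assumes S: "S \<subseteq> J"
  shows "lookup (taylor_cone V S) = taylor_cone_coeff V S"
proof -
  have "{t. taylor_cone_coeff V S t \<noteq> 0} \<subseteq>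
    (\<Union>j\<in>S. (\<lambda>t. t + squarefree_exp (cover S - cover (S - {j}))) -` keys (V (S - {j})))"
    by (auto simp: taylor_cone_coeff_def strand_def Let_def in_keys_iff shift_subset[OF S] split: if_splits)
  moreover have "finite \<dots>"
    using finite_face[OF S] by (intro finite_UN_I finite_vimageI) (auto intro: injI)
  ultimately have "finite {t. taylor_cone_coeff V S t \<noteq> 0}" by (rule finite_subset)
  then show ?thesis by (simp add: taylor_cone_def)
qed

lemma taylor_cone_in_mpolys:
  assumes S: "S \<subseteq> J" and V: "\<And>S. V S \<in> mpolys n"
  shows "taylor_cone V S \<in> mpolys n"
  unfolding mpolys_iff
proof
  fix t assume "t \<in> keys (taylor_cone V S)"
  then obtain j where "t + squarefree_exp (cover S - cover (S - {j})) \<in> keys (V (S - {j}))"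
    by (auto simp: in_keys_iff lookup_taylor_cone[OF S] taylor_cone_coeff_def strand_def Let_def shift_subset[OF S] split: if_splits)
  then show "keys t \<subseteq> {1..n}"
    using V[of "S - {j}"] by (fastforce simp: mpolys_iff keys_add_nat)
qed

lemma strand_taylor_cone:
  assumes "S \<subseteq> divisors T"
  shows "strand (taylor_cone V) T S = (if Min (divisors T) \<in> S then strand V T (S - {Min (divisors T)}) else 0)"
proof -
  have "S \<subseteq> J" using assms by (auto simp: divisors_def)
  then show ?thesis
    using cover_subset_keys[OF assms]
    by (simp add: strand_def lookup_taylor_cone taylor_cone_coeff_def squarefree_exp_diff_add finite_cover Let_def)
qed

text \<open>In a fixed multidegree the monomial coefficients disappear and the signed simplicial
  boundary on \<open>divisors T\<close> remains: the term of \<open>j\<close> contributes exactly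
  when the generator \<open>j\<close> divides the monomial with exponent \<open>T\<close>.\<close>

lemma strand_taylor_diff:
  assumes S: "S \<subseteq> divisors T"
  shows "strand (taylor_diff V) T S = (\<Sum>j\<in>divisors T - S. taylor_sign j S * strand V T (insert j S))"
proof -
  let ?t = "T - squarefree_exp (cover S)"
  have SJ: "S \<subseteq> J" using S by (auto simp: divisors_def)
  have keys: "keys ?t \<union> cover S = keys T"
  proof -
    have "keys (?t + squarefree_exp (cover S)) = keys T"
      by (simp add: squarefree_exp_diff_add finite_cover SJ cover_subset_keys S)
    then show ?thesis by (simp add: keys_add_nat keys_squarefree_exp finite_cover SJ)
  qed
  have "strand (taylor_diff V) T S = (\<Sum>j\<in>J - S. if A j - cover S \<subseteq> keys ?t
      then taylor_sign j S * lookup (V (insert j S)) (?t - squarefree_exp (A j - cover S)) else 0)"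
    unfolding strand_def taylor_diff_def lookup_sum
    by (intro sum.cong refl) (simp add: lookup_single_mult squarefree_exp_le_iff finite_A)
  also have "\<dots> = (\<Sum>j\<in>J - S. if j \<in> divisors T then taylor_sign j S * strand V T (insert j S) else 0)"
  proof (intro sum.cong refl)
    fix j assume j: "j \<in> J - S"
    have "A j - cover S \<subseteq> keys ?t \<longleftrightarrow> j \<in> divisors T"
      using keys j by (auto simp: divisors_def)
    moreover have "?t - squarefree_exp (A j - cover S) = T - squarefree_exp (cover (insert j S))"
      using finite_A[of j] j finite_cover[OF SJ]
      by (intro poly_mapping_eqI) (auto simp: lookup_minus lookup_squarefree_exp)
    ultimately show "(if A j - cover S \<subseteq> keys ?t
        then taylor_sign j S * lookup (V (insert j S)) (?t - squarefree_exp (A j - cover S)) else 0)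
      = (if j \<in> divisors T then taylor_sign j S * strand V T (insert j S) else 0)"
      by (simp add: strand_def)
  qed
  also have "\<dots> = (\<Sum>j\<in>divisors T - S. taylor_sign j S * strand V T (insert j S))"
    using finite_J by (intro sum.mono_neutral_cong_right) (auto simp: divisors_def)
  finally show ?thesis .
qed

text \<open>The contraction identity for cycles: every cycle is the boundary of its cone. The index
  \<open>Suc p\<close> makes \<open>S\<close> nonempty, so \<open>divisors T\<close> is nonempty and
  the least vertex exists.\<close>

lemma taylor_diff_taylor_cone:
  assumes V: "\<And>S. S \<in> faces p \<Longrightarrow> taylor_diff V S = 0" and S: "S \<in> faces (Suc p)"
  shows "taylor_diff (taylor_cone V) S = V S"
proof (rule poly_mapping_eqI)
  fix t
  have SJ: "S \<subseteq> J" using S by (auto simp: faces_def)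
  define T where "T = t + squarefree_exp (cover S)"
  define j where "j = Min (divisors T)"
  have t: "t = T - squarefree_exp (cover S)" by (simp add: T_def)
  have ST: "S \<subseteq> divisors T"
    using SJ by (intro subset_divisors) (auto simp: T_def keys_add_nat keys_squarefree_exp finite_cover)
  have "S \<noteq> {}" using S by (auto simp: faces_def)
  then have "divisors T \<noteq> {}" using ST by blast
  then have j: "j \<in> divisors T" and j_le: "\<And>i. i \<in> divisors T \<Longrightarrow> j \<le> i"
    unfolding j_def using finite_divisors by (auto intro: Min_in)
  \<comment> \<open>This is the reason for coning from the least vertex: nothing precedes it, so
    inserting it never costs a sign.\<close>
  have sign_j: "taylor_sign j S' = 1" if "S' \<subseteq> divisors T" for S'
  proof -
    have "{i\<in>S'. i < j} = {}" using that j_le by fastforce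
    then show ?thesis by (simp only: taylor_sign_def) simp
  qed
  have "strand (taylor_diff (taylor_cone V)) T S
      = (\<Sum>i\<in>divisors T - S. taylor_sign i S * (if j \<in> insert i S then strand V T (insert i S - {j}) else 0))"
    unfolding strand_taylor_diff[OF ST] j_def
    using ST by (intro sum.cong refl) (simp add: strand_taylor_cone)
  also have "\<dots> = strand V T S"
  proof (cases "j \<in> S")
    case False
    then have "(\<Sum>i\<in>divisors T - S. taylor_sign i S * (if j \<in> insert i S then strand V T (insert i S - {j}) else 0))
      = (\<Sum>i\<in>divisors T - S. if i = j then strand V T S else 0)"
      by (intro sum.cong refl) (auto simp: sign_j ST)
    then show ?thesis using j False finite_divisors by simp
  next
    case True
    define S' where "S' = S - {j}"
    have S': "S = insert j S'" "j \<notin> S'" "S' \<subseteq> divisors T" "finite S'"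
      using True ST finite_face[OF SJ] by (auto simp: S'_def)
    \<comment> \<open>If \<open>j\<close> already lies in \<open>S\<close>, the cycle condition at
      the face opposite to \<open>j\<close> expresses the coefficient at \<open>S\<close> through
      those at \<open>insert i S'\<close>; these are the values of the cone at
      \<open>insert i S\<close>.\<close>
    have "S' \<in> faces p" using S S' by (auto simp: faces_def)
    then have "0 = strand (taylor_diff V) T S'" by (simp add: strand_def V)
    also have "\<dots> = (\<Sum>i\<in>insert j (divisors T - S). taylor_sign i S' * strand V T (insert i S'))"
    proof -
      have "divisors T - S' = insert j (divisors T - S)" using S' j by auto
      then show ?thesis by (simp add: strand_taylor_diff[OF S'(3)])
    qed
    also have "\<dots> = strand V T S + (\<Sum>i\<in>divisors T - S. taylor_sign i S' * strand V T (insert i S'))"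
      using finite_divisors True by (simp add: sign_j S'(3) flip: S'(1))
    finally have "strand V T S = (\<Sum>i\<in>divisors T - S. - taylor_sign i S' * strand V T (insert i S'))"
      by (simp add: sum_negf eq_neg_iff_add_eq_0)
    also have "\<dots> = (\<Sum>i\<in>divisors T - S. taylor_sign i S * (if j \<in> insert i S then strand V T (insert i S - {j}) else 0))"
    proof (intro sum.cong refl)
      fix i assume i: "i \<in> divisors T - S"
      \<comment> \<open>Since \<open>j\<close> lies below \<open>i\<close>, passing from
        \<open>S'\<close> to \<open>S\<close> flips the sign at \<open>i\<close>, which absorbs the
        minus sign.\<close>
      then have "j < i" using j_le[of i] True by (cases "i = j") auto
      moreover have "insert i S - {j} = insert i S'" using i True by (auto simp: S'_def)
      ultimately show "- taylor_sign i S' * strand V T (insert i S') =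
          taylor_sign i S * (if j \<in> insert i S then strand V T (insert i S - {j}) else 0)"
        using True by (simp add: S'(1) taylor_sign_insert[OF S'(2,4)])
    qed
    finally show ?thesis by simp
  qed
  finally show "lookup (taylor_diff (taylor_cone V) S) t = lookup (V S) t"
    by (simp add: strand_def t)
qed

section \<open>The generated ideal, its Taylor resolution and its invariants\<close>

abbreviation generator :: "nat \<Rightarrow> 'k::field mpoly" where
  "generator j \<equiv> Poly_Mapping.single (squarefree_exp (A j)) 1"

abbreviation generated_ideal :: "'k::field mpoly set" where
  "generated_ideal \<equiv> Idl\<^bsub>mpoly_ring n\<^esub> (generator ` J)"

lemma generators_in_mpolys: "generator ` J \<subseteq> mpolys n"
  by (intro image_subsetI mpolys_single) (simp add: keys_squarefree_exp finite_A A_subset del: One_nat_def)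

lemmas generated_ideal_eq = genideal_image[OF finite_J generators_in_mpolys]

lemma generated_ideal_irrelevant: "generated_ideal \<subseteq> irrelevant_ideal n"
proof -
  have "generator j \<in> irrelevant_ideal n" if j: "j \<in> J" for j
  proof (rule monomial_in_irrelevant)
    have "A j \<noteq> {}" using private_element[OF j] by auto
    then show "squarefree_exp (A j) \<noteq> 0"
      using keys_squarefree_exp[OF finite_A[OF j]] by auto
  qed (use A_subset[OF j] in \<open>simp add: keys_squarefree_exp finite_A j\<close>)
  then show ?thesis
    unfolding generated_ideal_eq
    by (auto intro!: ideal_mpoly_ring_sum[OF ideal_irrelevant] ideal_mpoly_ringD(4)[OF ideal_irrelevant]
        simp: image_subset_iff)
qed

lemma generated_ideal_in_mpolys: "generated_ideal \<subseteq> mpolys n"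
  using generated_ideal_irrelevant ideal_mpoly_ringD(1)[OF ideal_irrelevant] by blast

text \<open>The last differential is the augmentation: over the empty face the cover is empty and
  every sign is 1.\<close>

lemma taylor_diff_empty: "taylor_diff V {} = (\<Sum>j\<in>J. V {j} * generator j)"
  by (simp add: taylor_diff_def taylor_sign_def cover_def mult.commute)

lemma taylor_resolution:
  "augmented_resolution n (generated_ideal :: 'k::field mpoly set) taylor_degrees taylor_map"
  unfolding augmented_resolution_def
proof (intro conjI allI taylor_map_hom subsetI)
  show D0: "taylor_degrees 0 = [0]" by (simp add: taylor_degrees_def face_list_0 cover_def)
  show "taylor_map 0 ` free n (taylor_degrees 1) = {v \<in> free n [0]. v 0 \<in> (generated_ideal :: 'k mpoly set)}"
  proof (intro equalityI subsetI)
    fix w :: "nat \<Rightarrow> 'k mpoly" assume "w \<in> taylor_map 0 ` free n (taylor_degrees 1)"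
    then obtain v where v: "v \<in> free n (taylor_degrees (Suc 0))" "w = taylor_map 0 v" by auto
    then obtain V where V: "v = vec (Suc 0) V" "\<And>S. V S \<in> mpolys n" using free_obtain_vec by blast
    have "w 0 = (\<Sum>j\<in>J. V {j} * generator j)"
      unfolding v(2) V(1) taylor_map_vec by (simp add: taylor_diff_empty vec_def face_list_0)
    then have "w 0 \<in> generated_ideal"
      unfolding generated_ideal_eq using V(2) by (auto intro!: exI[of _ "\<lambda>j. V {j}"])
    moreover have "w \<in> free n [0]"
      using free_homD(1)[OF taylor_map_hom v(1)] v(2) by (simp add: D0)
    ultimately show "w \<in> {v \<in> free n [0]. v 0 \<in> generated_ideal}" by simp
  next
    fix w :: "nat \<Rightarrow> 'k mpoly" assume w: "w \<in> {v \<in> free n [0]. v 0 \<in> generated_ideal}"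
    then obtain v where v: "v ` J \<subseteq> mpolys n" "w 0 = (\<Sum>j\<in>J. v j * generator j)"
      unfolding generated_ideal_eq by blast
    define V where "V S = v (the_elem S)" for S
    have "w = taylor_map 0 (vec (Suc 0) V)"
    proof
      fix s
      show "w s = taylor_map 0 (vec (Suc 0) V) s"
        unfolding taylor_map_vec using w v(2)
        by (cases s) (simp_all add: vec_def face_list_0 taylor_diff_empty V_def free_iff)
    qed
    moreover have "vec (Suc 0) V \<in> free n (taylor_degrees (Suc 0))"
      using v(1) by (intro vec_free) (auto simp: faces_def V_def card_Suc_eq)
    ultimately show "w \<in> taylor_map 0 ` free n (taylor_degrees 1)" by auto
  qed
next
  fix p
  show "taylor_map (Suc p) ` free n (taylor_degrees (Suc (Suc p)))
      = {v \<in> free n (taylor_degrees (Suc p)). taylor_map p v = (\<lambda>s. 0 :: 'k mpoly)}"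
  proof (intro equalityI subsetI)
    fix w :: "nat \<Rightarrow> 'k mpoly" assume "w \<in> taylor_map (Suc p) ` free n (taylor_degrees (Suc (Suc p)))"
    then obtain v where v: "v \<in> free n (taylor_degrees (Suc (Suc p)))" "w = taylor_map (Suc p) v" by auto
    then obtain V where V: "v = vec (Suc (Suc p)) V" using free_obtain_vec by blast
    have "taylor_map p w = vec p (\<lambda>S. 0)"
      unfolding v(2) V taylor_map_vec vec_eq_iff using taylor_diff_diff by (auto simp: faces_def)
    then show "w \<in> {v \<in> free n (taylor_degrees (Suc p)). taylor_map p v = (\<lambda>s. 0)}"
      using v free_homD(1)[OF taylor_map_hom v(1)] by (simp add: vec_zero)
  next
    fix w :: "nat \<Rightarrow> 'k mpoly"
    assume w: "w \<in> {v \<in> free n (taylor_degrees (Suc p)). taylor_map p v = (\<lambda>s. 0)}"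
    then obtain V where V: "w = vec (Suc p) V" "\<And>S. V S \<in> mpolys n" using free_obtain_vec by blast
    have "vec p (taylor_diff V) = vec p (\<lambda>S. 0)"
      using w by (simp add: V(1) taylor_map_vec vec_zero)
    then have "taylor_diff V S = 0" if "S \<in> faces p" for S
      using that by (simp add: vec_eq_iff)
    then have "w = taylor_map (Suc p) (vec (Suc (Suc p)) (taylor_cone V))"
      unfolding V(1) taylor_map_vec vec_eq_iff by (metis taylor_diff_taylor_cone)
    moreover have "vec (Suc (Suc p)) (taylor_cone V) \<in> free n (taylor_degrees (Suc (Suc p)))"
      using V(2) by (intro vec_free taylor_cone_in_mpolys) (auto simp: faces_def)
    ultimately show "w \<in> taylor_map (Suc p) ` free n (taylor_degrees (Suc (Suc p)))" by blast
  qed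
next
  fix p and w :: "nat \<Rightarrow> 'k mpoly" assume "w \<in> taylor_map p ` free n (taylor_degrees (Suc p))"
  then show "w \<in> irrelevant_submodule n (taylor_degrees p)" using taylor_map_minimal by blast
qed

text \<open>The Taylor resolution witnesses existence, so the chosen resolution is a minimal one and
  shares its degree sets. The index \<open>Suc i\<close> undoes the shift caused by the ring in
  position 0.\<close>

lemma betti_nonzero_iff:
  "betti n (generated_ideal :: 'k::field mpoly set) i d \<noteq> 0 \<longleftrightarrow>
     (\<exists>S\<subseteq>J. card S = Suc i \<and> d = int (card (cover S)))"
proof -
  let ?I = "generated_ideal :: 'k mpoly set"
  have "\<exists>e \<phi>. min_graded_free_resolution n ?I (min_resolution_degrees n ?I) e \<phi>"
    unfolding min_resolution_degrees_def
    using min_graded_free_resolution_of_augmented_resolution[OF taylor_resolution generated_ideal_in_mpolys]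
    by (intro someI_ex[of "\<lambda>D. \<exists>e \<phi>. min_graded_free_resolution n ?I D e \<phi>"]) blast
  then obtain e \<phi> where "min_graded_free_resolution n ?I (min_resolution_degrees n ?I) e \<phi>" by blast
  from augmented_resolution_degrees_eq[OF augmented_resolution_of_min_graded_free_resolution[OF this
        generated_ideal_irrelevant generated_ideal_in_mpolys] taylor_resolution, of "Suc i"]
  have "set (min_resolution_degrees n ?I i) = (\<lambda>S. int (card (cover S))) ` faces (Suc i)"
    by (simp add: taylor_degrees_def face_list(2))
  then show ?thesis
    by (auto simp: betti_def count_list_0_iff faces_def)
qed

lemma pd_generated_ideal:
  assumes "J \<noteq> {}"
  shows "pd n (generated_ideal :: 'k::field mpoly set) = card J - 1"
proof -
  have "{i. \<exists>d. betti n (generated_ideal :: 'k mpoly set) i d \<noteq> 0} = {..<card J}"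
  proof (intro equalityI subsetI)
    fix i assume "i \<in> {i. \<exists>d. betti n (generated_ideal :: 'k mpoly set) i d \<noteq> 0}"
    then obtain S where "S \<subseteq> J" "card S = Suc i" unfolding betti_nonzero_iff by blast
    then show "i \<in> {..<card J}" using card_mono[OF finite_J, of S] by simp
  next
    fix i assume "i \<in> {..<card J}"
    then obtain S where "S \<subseteq> J" "card S = Suc i"
      using obtain_subset_with_card_n[of "Suc i" J] by auto
    then show "i \<in> {i. \<exists>d. betti n (generated_ideal :: 'k mpoly set) i d \<noteq> 0}"
      unfolding betti_nonzero_iff by blast
  qed
  moreover have "card J > 0" using assms finite_J by (simp add: card_gt_0_iff)
  ultimately show ?thesis unfolding pd_def by (auto intro!: Max_eqI)
qed

text \<open>The private variables of the generators in \<open>J - S\<close> are distinct and lie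
  outside \<open>cover S\<close>. Written additively, this says that
  \<open>card (cover S) - card S\<close> is largest at \<open>S = J\<close>.\<close>

lemma card_cover_le:
  assumes S: "S \<subseteq> J"
  shows "card (cover S) + card J \<le> card (cover J) + card S"
proof -
  obtain x where x: "x j \<in> A j" "\<forall>i\<in>J - {j}. x j \<notin> A i" if "j \<in> J" for j
    using private_element by metis
  have "card (J - S) = card (x ` (J - S))"
    using x by (intro card_image[symmetric] inj_onI) (metis DiffD1 DiffI singletonD)
  also have "\<dots> \<le> card (cover J - cover S)"
  proof (rule card_mono)
    show "finite (cover J - cover S)" using finite_cover by simp
    show "x ` (J - S) \<subseteq> cover J - cover S"
      using x S by (fastforce simp: cover_def)
  qed
  finally have "card (J - S) \<le> card (cover J - cover S)" .
  moreover have "cover S \<subseteq> cover J" using S by (auto simp: cover_def)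
  ultimately show ?thesis
    using S finite_J card_mono[OF finite_J S] card_mono[OF finite_cover[OF order_refl], of "cover S"]
    by (simp add: card_Diff_subset finite_face finite_cover)
qed

lemma reg_generated_ideal:
  assumes "J \<noteq> {}"
  shows "reg n (generated_ideal :: 'k::field mpoly set) = int (card (cover J)) - int (card J) + 1"
proof -
  let ?B = "{d - int i | i d. betti n (generated_ideal :: 'k mpoly set) i d \<noteq> 0}"
  \<comment> \<open>A face \<open>S\<close> sits in homological degree \<open>card S - 1\<close>,
    which accounts for the \<open>+ 1\<close>.\<close>
  have eq: "?B = (\<lambda>S. int (card (cover S)) - int (card S) + 1) ` {S. S \<subseteq> J \<and> S \<noteq> {}}"
  proof (intro equalityI subsetI)
    fix r assume "r \<in> ?B"
    then obtain i S where "S \<subseteq> J" "card S = Suc i" "r = int (card (cover S)) - int i"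
      unfolding betti_nonzero_iff by blast
    then show "r \<in> (\<lambda>S. int (card (cover S)) - int (card S) + 1) ` {S. S \<subseteq> J \<and> S \<noteq> {}}"
      by (intro image_eqI[of _ _ S]) auto
  next
    fix r assume "r \<in> (\<lambda>S. int (card (cover S)) - int (card S) + 1) ` {S. S \<subseteq> J \<and> S \<noteq> {}}"
    then obtain S where S: "S \<subseteq> J" "S \<noteq> {}" "r = int (card (cover S)) - int (card S) + 1" by blast
    then have "card S > 0" using finite_face by (simp add: card_gt_0_iff)
    then obtain i where i: "card S = Suc i" using gr0_conv_Suc by blast
    have "betti n (generated_ideal :: 'k mpoly set) i (int (card (cover S))) \<noteq> 0"
      unfolding betti_nonzero_iff using S(1) i by blast
    moreover have "r = int (card (cover S)) - int i" using S(3) i by simp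
    ultimately show "r \<in> ?B" by blast
  qed
  show ?thesis unfolding reg_def eq
  proof (rule Max_eqI)
    show "finite ((\<lambda>S. int (card (cover S)) - int (card S) + 1) ` {S. S \<subseteq> J \<and> S \<noteq> {}})"
      using finite_J by simp
    show "r \<le> int (card (cover J)) - int (card J) + 1"
      if r_in: "r \<in> (\<lambda>S. int (card (cover S)) - int (card S) + 1) ` {S. S \<subseteq> J \<and> S \<noteq> {}}" for r
    proof -
      obtain S where S: "S \<subseteq> J" and r: "r = int (card (cover S)) - int (card S) + 1" using r_in by blast
      show ?thesis using card_cover_le[OF S] by (simp add: r)
    qed
    show "int (card (cover J)) - int (card J) + 1
        \<in> (\<lambda>S. int (card (cover S)) - int (card S) + 1) ` {S. S \<subseteq> J \<and> S \<noteq> {}}"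
      using assms by (intro image_eqI[of _ _ J]) auto
  qed
qed

end

subsection \<open>Path ideals\<close>

lemma path_monomial_eq:
  "(path_monomial m l i :: 'k::field mpoly) =
     Poly_Mapping.single (squarefree_exp {(i - 1) * (m - l) + 1..(i - 1) * (m - l) + m}) 1"
proof -
  have "(\<Prod>j\<in>B. mvar (f j) :: 'k mpoly) = Poly_Mapping.single (\<Sum>j\<in>B. Poly_Mapping.single (f j) 1) 1"
    for f and B :: "nat set"
    by (induction B rule: infinite_finite_induct) (simp_all add: mvar_def mult_single)
  moreover have "(\<Sum>j\<in>{c + 1..c + m}. Poly_Mapping.single j 1) = (\<Sum>j=1..m. Poly_Mapping.single (c + j) (1::nat))"
    for c :: nat
    using sum.shift_bounds_cl_nat_ivl[of "\<lambda>j. Poly_Mapping.single j (1::nat)" 1 c m] by (simp add: add.commute)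
  ultimately show ?thesis by (simp add: path_monomial_def squarefree_exp_def)
qed

text \<open>The block after the first \<open>k\<close> starts at \<open>k * (m - l) + 1\<close>,
  within or directly after what is already covered, and ends at \<open>k * (m - l) + m\<close>,
  which is \<open>Suc k * (m - l) + l\<close>.\<close>

lemma Union_path_blocks:
  fixes k l m :: nat
  assumes "k \<ge> 1" "l \<le> m"
  shows "(\<Union>i\<in>{1..k}. {(i - 1) * (m - l) + 1..(i - 1) * (m - l) + m}) = {1..k * (m - l) + l}"
  using assms(1)
proof (induction k rule: dec_induct)
  case base
  then show ?case using assms(2) by simp
next
  case (step k)
  have "{1..Suc k} = insert (Suc k) {1..k}" by auto
  then have "(\<Union>i\<in>{1..Suc k}. {(i - 1) * (m - l) + 1..(i - 1) * (m - l) + m})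
      = {k * (m - l) + 1..k * (m - l) + m} \<union> {1..k * (m - l) + l}"
    using step.IH by simp
  also have "\<dots> = {1..Suc k * (m - l) + l}" using assms(2) by auto
  finally show ?case .
qed

theorem theorem3p5:
  fixes k l m n :: nat
  assumes "n = k * (m - l) + l"
    and "k \<ge> 1" and "m \<ge> 2"
    and "1 \<le> l" and "int l < \<lceil>real m / 2\<rceil>"
  shows "pd n (path_ideal n m l k :: 'k::field mpoly set) = k - 1 \<and>
         reg n (path_ideal n m l k :: 'k mpoly set)
           = (int k - 1) * (int m - int l - 1) + int m"
proof -
  define A where "A i = {(i - 1) * (m - l) + 1..(i - 1) * (m - l) + m}" for i :: nat
  have l: "2 * l < m" using assms(5) by linarith
  have cover: "(\<Union>i\<in>{1..k}. A i) = {1..n}"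
    unfolding A_def assms(1) using assms(2) l by (intro Union_path_blocks) auto
  interpret squarefree_ideal n "{1..k}" A
  proof
    show "A j \<subseteq> {1..n}" if "j \<in> {1..k}" for j using cover that by blast
    fix j assume j: "j \<in> {1..k}"
    show "\<exists>x\<in>A j. \<forall>i\<in>{1..k} - {j}. x \<notin> A i"
    proof (intro bexI ballI)
      \<comment> \<open>Position \<open>l + 1\<close> of block \<open>j\<close>. The preceding block
        covers its first \<open>l\<close> positions and the following one its last \<open>l\<close>,
        so positions \<open>l + 1\<close> to \<open>m - l\<close> are private;
        \<open>2 * l < m\<close> makes this range nonempty.\<close>
      let ?x = "(j - 1) * (m - l) + l + 1"
      show "?x \<in> A j" using l by (auto simp: A_def)
      fix i assume i: "i \<in> {1..k} - {j}"
      show "?x \<notin> A i"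
      proof (cases "i < j")
        case True
        then have "((i - 1) + 1) * (m - l) \<le> (j - 1) * (m - l)" using i by (intro mult_le_mono1) auto
        then have "(i - 1) * (m - l) + m < ?x" using l unfolding add_mult_distrib by linarith
        then show ?thesis by (simp only: A_def atLeastAtMost_iff) linarith
      next
        case False
        then have "((j - 1) + 1) * (m - l) \<le> (i - 1) * (m - l)" using i j by (intro mult_le_mono1) auto
        then have "?x < (i - 1) * (m - l) + 1" using l unfolding add_mult_distrib by linarith
        then show ?thesis by (simp only: A_def atLeastAtMost_iff) linarith
      qed
    qed
  qed simp
  have ideal: "path_ideal n m l k = (generated_ideal :: 'k mpoly set)"
    unfolding path_ideal_def A_def path_monomial_eq ..
  \<comment> \<open>The lcm of all generators has degree \<open>n\<close>, so the regularity is
    \<open>n - k + 1\<close>; the rest is integer arithmetic, where \<open>l < m\<close> makes the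
    natural subtraction exact.\<close>
  have "int n = int k * (int m - int l) + int l"
    using l by (simp add: assms(1) of_nat_diff)
  then have "int (card (cover {1..k})) - int (card {1..k}) + 1 = (int k - 1) * (int m - int l - 1) + int m"
    unfolding cover_def cover by (simp add: algebra_simps)
  then show ?thesis
    unfolding ideal using assms(2) pd_generated_ideal reg_generated_ideal by simp
qed

end
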